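(* Let $1\le r\le\infty$ and let $\omega$ be a $(0,n)$-form with coefficient in $L^{r}_{c}(\mathbb{D}^n)$ such that there is a $(0,n-1)$-current $T$, compactly supported in $\mathbb{D}^n$, with $\bar\partial T=\omega$. Then there is a $(0,n-1)$-form $\eta$ with coefficients in $L^{r}_{c}(\mathbb{D}^n)$ such that $\bar\partial\eta=\omega$.
   Context: $\mathbb{D}^n$ is the open unit polydisc in $\mathbb{C}^n$. $L^r_c(\mathbb{D}^n)$ is the space of $L^r$ functions with compact support contained in $\mathbb{D}^n$. A $(0,q)$-current is a $(0,q)$-form with distribution coefficients, and $\bar\partial$ is taken in the sense of distributions. *)

theory Defs
  imports "HOL-Analysis.Analysis"
begin

definition polydisc :: "(complex^'n) set" where
  "polydisc = {z. \<forall>j. cmod (z $ j) < 1}"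

subsection \<open>Smooth functions and test functions\<close>

definition dir_deriv :: "'a::euclidean_space \<Rightarrow> ('a \<Rightarrow> complex) \<Rightarrow> 'a \<Rightarrow> complex" where
  "dir_deriv v f x = frechet_derivative f (at x) v"

text \<open>Iterated real partial derivatives; a list of basis vectors plays the role of a multi-index.\<close>

fun iter_deriv :: "'a::euclidean_space list \<Rightarrow> ('a \<Rightarrow> complex) \<Rightarrow> 'a \<Rightarrow> complex" where
  "iter_deriv [] f = f"
| "iter_deriv (v # vs) f = dir_deriv v (iter_deriv vs f)"

text \<open>If all iterated partial derivatives are differentiable, they are all continuous, so this is
  the class \<open>C\<^sup>\<infinity>\<close> in the real sense.\<close>

definition smooth_fun :: "('a::euclidean_space \<Rightarrow> complex) \<Rightarrow> bool" where
  "smooth_fun f \<longleftrightarrow> (\<forall>vs. set vs \<subseteq> Basis \<longrightarrow> iter_deriv vs f differentiable_on UNIV)"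

definition fun_support :: "('a::topological_space \<Rightarrow> complex) \<Rightarrow> 'a set" where
  "fun_support f = closure {x. f x \<noteq> 0}"

text \<open>Test functions on \<open>\<Omega>\<close> are extended by zero to the whole space.\<close>

definition test_functions :: "'a::euclidean_space set \<Rightarrow> ('a \<Rightarrow> complex) set" where
  "test_functions \<Omega> =
     {\<phi>. smooth_fun \<phi> \<and> compact (fun_support \<phi>) \<and> fun_support \<phi> \<subseteq> \<Omega>}"

subsection \<open>Distributions\<close>

text \<open>A distribution is represented by a functional of which only the values on test functions
  matter.  Continuity is stated by the usual seminorm estimates on compact sets.\<close>

definition distribution_on ::
    "'a::euclidean_space set \<Rightarrow> (('a \<Rightarrow> complex) \<Rightarrow> complex) \<Rightarrow> bool" where
  "distribution_on \<Omega> T \<longleftrightarrow>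
     (\<forall>\<phi>\<in>test_functions \<Omega>. \<forall>\<psi>\<in>test_functions \<Omega>. T (\<lambda>x. \<phi> x + \<psi> x) = T \<phi> + T \<psi>) \<and>
     (\<forall>c. \<forall>\<phi>\<in>test_functions \<Omega>. T (\<lambda>x. c * \<phi> x) = c * T \<phi>) \<and>
     (\<forall>K. compact K \<and> K \<subseteq> \<Omega> \<longrightarrow>
        (\<exists>C::real. \<exists>N::nat. \<forall>\<phi>\<in>test_functions \<Omega>. fun_support \<phi> \<subseteq> K \<longrightarrow>
           cmod (T \<phi>) \<le> C * (\<Sum>vs | set vs \<subseteq> Basis \<and> length vs \<le> N.
                                SUP x. cmod (iter_deriv vs \<phi> x))))"

definition distr_support ::
    "'a::euclidean_space set \<Rightarrow> (('a \<Rightarrow> complex) \<Rightarrow> complex) \<Rightarrow> 'a set" where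
  "distr_support \<Omega> T =
     {x\<in>\<Omega>. \<not> (\<exists>U. open U \<and> x \<in> U \<and> U \<subseteq> \<Omega> \<and> (\<forall>\<phi>\<in>test_functions U. T \<phi> = 0))}"

definition distr_of_fun ::
    "'a::euclidean_space set \<Rightarrow> ('a \<Rightarrow> complex) \<Rightarrow> ('a \<Rightarrow> complex) \<Rightarrow> complex" where
  "distr_of_fun \<Omega> f \<phi> = (LINT x|lebesgue_on \<Omega>. f x * \<phi> x)"

text \<open>With \<open>z\<^sub>j = x\<^sub>j + \<i> y\<^sub>j\<close> this is
  \<open>\<partial>\<phi>/\<partial>z\<^sub>j\<^sup>- = (\<partial>\<phi>/\<partial>x\<^sub>j + \<i> \<partial>\<phi>/\<partial>y\<^sub>j) / 2\<close>.\<close>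

definition dzbar :: "'n::finite \<Rightarrow> (complex^'n \<Rightarrow> complex) \<Rightarrow> complex^'n \<Rightarrow> complex" where
  "dzbar j \<phi> z = (dir_deriv (axis j 1) \<phi> z + \<i> * dir_deriv (axis j \<i>) \<phi> z) / 2"

definition distr_dzbar ::
    "'n::finite \<Rightarrow> ((complex^'n \<Rightarrow> complex) \<Rightarrow> complex) \<Rightarrow> (complex^'n \<Rightarrow> complex) \<Rightarrow> complex" where
  "distr_dzbar j T \<phi> = - T (dzbar j \<phi>)"

subsection \<open>Forms and currents of bidegree (0,q)\<close>

text \<open>A (0,q)-form or (0,q)-current \<open>\<Sum>\<^sub>I T\<^sub>I dz\<^sub>I\<^sup>-\<close> is the family of its coefficients, indexed by
  the sets \<open>I\<close> of coordinates with \<open>q\<close> elements; \<open>dz\<^sub>I\<^sup>-\<close> is the wedge product of the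
  \<open>dz\<^sub>i\<^sup>-\<close>, \<open>i \<in> I\<close>, in increasing order.  The values of the family at sets of a different
  cardinality are irrelevant.\<close>

type_synonym 'n form = "'n set \<Rightarrow> complex^'n \<Rightarrow> complex"
type_synonym 'n current = "'n set \<Rightarrow> (complex^'n \<Rightarrow> complex) \<Rightarrow> complex"

definition current_on :: "(complex^'n::finite) set \<Rightarrow> nat \<Rightarrow> 'n current \<Rightarrow> bool" where
  "current_on \<Omega> q T \<longleftrightarrow> (\<forall>I. card I = q \<longrightarrow> distribution_on \<Omega> (T I))"

definition current_support ::
    "(complex^'n::finite) set \<Rightarrow> nat \<Rightarrow> 'n current \<Rightarrow> (complex^'n) set" where
  "current_support \<Omega> q T = (\<Union>I\<in>{I. card I = q}. distr_support \<Omega> (T I))"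

definition current_eq ::
    "(complex^'n::finite) set \<Rightarrow> nat \<Rightarrow> 'n current \<Rightarrow> 'n current \<Rightarrow> bool" where
  "current_eq \<Omega> q S T \<longleftrightarrow>
     (\<forall>I. card I = q \<longrightarrow> (\<forall>\<phi>\<in>test_functions \<Omega>. S I \<phi> = T I \<phi>))"

definition current_of_form :: "(complex^'n::finite) set \<Rightarrow> 'n form \<Rightarrow> 'n current" where
  "current_of_form \<Omega> \<eta> I = distr_of_fun \<Omega> (\<eta> I)"

text \<open>The sign comes from \<open>dz\<^sub>j\<^sup>- \<and> dz\<^sub>I\<^sup>- = (-1)\<^sup>k dz\<^sub>J\<^sup>-\<close>, where \<open>J = I \<union> {j}\<close>, \<open>j \<notin> I\<close>, and \<open>k\<close> is
  the number of elements of \<open>I\<close> below \<open>j\<close>.\<close>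

definition dbar :: "'n::{finite,linorder} current \<Rightarrow> 'n current" where
  "dbar T J \<phi> = (\<Sum>j\<in>J. (-1) ^ card {i\<in>J. i < j} * distr_dzbar j (T (J - {j})) \<phi>)"

subsection \<open>Compactly supported functions in \<open>L\<^sup>r\<close>\<close>

definition in_Lr :: "ennreal \<Rightarrow> 'a::euclidean_space set \<Rightarrow> ('a \<Rightarrow> complex) \<Rightarrow> bool" where
  "in_Lr r \<Omega> f \<longleftrightarrow>
     f \<in> borel_measurable (lebesgue_on \<Omega>) \<and>
     (if r = \<infinity> then (\<exists>C::real. AE x in lebesgue_on \<Omega>. cmod (f x) \<le> C)
      else integrable (lebesgue_on \<Omega>) (\<lambda>x. cmod (f x) powr enn2real r))"

text \<open>The support of an almost everywhere class: the complement in \<open>\<Omega>\<close> of the largest open subset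
  on which \<open>f\<close> vanishes almost everywhere.\<close>

definition ess_support :: "'a::euclidean_space set \<Rightarrow> ('a \<Rightarrow> complex) \<Rightarrow> 'a set" where
  "ess_support \<Omega> f =
     {x\<in>\<Omega>. \<not> (\<exists>U. open U \<and> x \<in> U \<and> U \<subseteq> \<Omega> \<and> (AE y in lebesgue_on U. f y = 0))}"

definition in_Lr_c :: "ennreal \<Rightarrow> 'a::euclidean_space set \<Rightarrow> ('a \<Rightarrow> complex) \<Rightarrow> bool" where
  "in_Lr_c r \<Omega> f \<longleftrightarrow> in_Lr r \<Omega> f \<and> compact (ess_support \<Omega> f)"

definition Lr_c_form :: "ennreal \<Rightarrow> (complex^'n::finite) set \<Rightarrow> nat \<Rightarrow> 'n form \<Rightarrow> bool" where
  "Lr_c_form r \<Omega> q \<eta> \<longleftrightarrow> (\<forall>I. card I = q \<longrightarrow> in_Lr_c r \<Omega> (\<eta> I))"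

end

theory Submission
  imports Defs
begin

text \<open>
  Let \<open>f\<close> be the coefficient of \<open>\<omega>\<close>.  Testing \<open>\<omega> = \<partial>\<^sup>-T\<close> against functions that are holomorphic near
  the support of \<open>T\<close> shows that \<open>f\<close> is orthogonal to them.  Now solve one coordinate at a time: with
  \<open>C\<^sub>j\<close> the Cauchy transform in \<open>z\<^sub>j\<close> and a cutoff \<open>\<theta>\<^sub>j\<close> in \<open>z\<^sub>j\<close> that is \<open>1\<close> near the support,
  \<open>g = \<partial>\<^sub>j\<^sup>-(\<theta>\<^sub>j C\<^sub>j g) - (\<partial>\<^sub>j\<^sup>-\<theta>\<^sub>j) C\<^sub>j g\<close>.  Both terms on the right are compactly supported and in
  \<open>L\<^sup>r\<close>, since \<open>C\<^sub>j\<close> is convolution with a kernel which may be truncated to an integrable one.  The remainder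
  \<open>- (\<partial>\<^sub>j\<^sup>-\<theta>\<^sub>j) C\<^sub>j g\<close> is orthogonal to all functions that are holomorphic in the coordinates not yet
  treated, because the adjoint of this step maps such a function to one that is also holomorphic in
  \<open>z\<^sub>j\<close> near the support.  After all coordinates the remainder is orthogonal to every test function, so
  it vanishes.
\<close>

section \<open>Smooth functions and distributions\<close>

text \<open>The current \<open>T\<close> enters only through a support argument; the orthogonality
  it yields is all that the construction in \<open>L\<^sup>r\<close> sees. The obstacle is that the
  Cauchy transform of a compactly supported function need not have compact support, and that cutting
  it off leaves an error. The error is harmless because it is again compactly supported and in
  \<open>L\<^sup>r\<close>, and keeps the orthogonality in the remaining variables. For this,
  "holomorphic near the support" needs a form that survives the adjoint step: \<open>h\<close> is a
  test function on the whole space with \<open>dzbar i h z = 0\<close> as soon as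
  \<open>cmod (z $ i) < a\<close>, whatever the other coordinates are, since the adjoint in one
  coordinate moves points far along that coordinate. The kernel is truncated at radius 3 because
  \<open>cmod (z $ j) < 1\<close> and \<open>cmod t > 3\<close> put \<open>z $ j + t\<close> outside
  the disc of radius 2, where the cutoffs vanish anyway. All estimates concern Borel functions
  defined everywhere on the whole space, so that supports are pointwise and translation invariance
  and Fubini apply directly.\<close>

lemma dir_deriv_eqI:
  "(f has_derivative f') (at x) \<Longrightarrow> dir_deriv v f x = f' v"
  unfolding dir_deriv_def by (metis frechet_derivative_at)

text \<open>Smoothness is always proved by exhibiting a class of differentiable functions that is closed
  under partial derivatives.\<close>

lemma smooth_fun_coinduct:
  assumes "f \<in> X"
    and "\<And>g. g \<in> X \<Longrightarrow> g differentiable_on UNIV"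
    and "\<And>g b. g \<in> X \<Longrightarrow> b \<in> Basis \<Longrightarrow> dir_deriv b g \<in> X"
  shows "smooth_fun f"
proof -
  have "iter_deriv vs f \<in> X" if "set vs \<subseteq> Basis" for vs
    using that assms(1,3) by (induction vs) auto
  then show ?thesis
    using assms(2) by (auto simp: smooth_fun_def)
qed

lemma iter_deriv_append: "iter_deriv (us @ vs) f = iter_deriv us (iter_deriv vs f)"
  by (induction us) auto

lemma smooth_fun_dir_deriv:
  assumes "smooth_fun f" "b \<in> Basis"
  shows "smooth_fun (dir_deriv b f)"
  unfolding smooth_fun_def
proof (intro allI impI)
  fix vs :: "'a list" assume "set vs \<subseteq> Basis"
  then have "iter_deriv (vs @ [b]) f differentiable_on UNIV"
    using assms unfolding smooth_fun_def by (metis Un_insert_right append_Nil2 insert_subset list.simps(15) set_append sup_bot.right_neutral list.set(1))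
  then show "iter_deriv vs (dir_deriv b f) differentiable_on UNIV"
    by (simp add: iter_deriv_append)
qed

lemma smooth_fun_differentiable_on: "smooth_fun f \<Longrightarrow> f differentiable_on UNIV"
  unfolding smooth_fun_def by (metis iter_deriv.simps(1) list.set(1) empty_subsetI)

lemma smooth_fun_differentiable: "smooth_fun f \<Longrightarrow> f differentiable (at x)"
  using smooth_fun_differentiable_on by (auto simp: differentiable_on_def)

lemma smooth_fun_has_derivative:
  "smooth_fun f \<Longrightarrow> (f has_derivative (\<lambda>v. dir_deriv v f x)) (at x)"
  unfolding dir_deriv_def using smooth_fun_differentiable frechet_derivative_works by blast

lemma smooth_fun_continuous_on: "smooth_fun f \<Longrightarrow> continuous_on A f"
  using smooth_fun_differentiable_on differentiable_imp_continuous_on continuous_on_subset by blast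

lemma smooth_fun_borel_measurable: "smooth_fun f \<Longrightarrow> f \<in> borel_measurable borel"
  by (intro borel_measurable_continuous_onI smooth_fun_continuous_on)

text \<open>Derivatives of \<open>1/f\<close> or of a flat function leave the given family but
  remain polynomials in it and known smooth functions; sums and products are therefore
  adjoined.\<close>

inductive_set gen_algebra :: "('a::euclidean_space \<Rightarrow> complex) set \<Rightarrow> ('a \<Rightarrow> complex) set"
  for G where
  gen: "g \<in> G \<Longrightarrow> g \<in> gen_algebra G"
| add: "f \<in> gen_algebra G \<Longrightarrow> g \<in> gen_algebra G \<Longrightarrow> (\<lambda>x. f x + g x) \<in> gen_algebra G"
| mult: "f \<in> gen_algebra G \<Longrightarrow> g \<in> gen_algebra G \<Longrightarrow> (\<lambda>x. f x * g x) \<in> gen_algebra G"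

lemma dir_deriv_add:
  assumes "f differentiable (at x)" "g differentiable (at x)"
  shows "dir_deriv v (\<lambda>x. f x + g x) x = dir_deriv v f x + dir_deriv v g x"
  using has_derivative_add[of f "frechet_derivative f (at x)" "at x" g "frechet_derivative g (at x)"]
    assms dir_deriv_eqI by (fastforce simp: dir_deriv_def frechet_derivative_works[symmetric])

lemma dir_deriv_mult:
  fixes f g :: "'a::euclidean_space \<Rightarrow> complex"
  assumes "f differentiable (at x)" "g differentiable (at x)"
  shows "dir_deriv v (\<lambda>x. f x * g x) x = dir_deriv v f x * g x + f x * dir_deriv v g x"
proof -
  have "((\<lambda>x. f x * g x) has_derivative
          (\<lambda>h. f x * frechet_derivative g (at x) h + frechet_derivative f (at x) h * g x)) (at x)"
    using assms by (intro has_derivative_mult) (simp_all add: frechet_derivative_works[symmetric])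
  from dir_deriv_eqI[OF this] show ?thesis by (simp add: dir_deriv_def)
qed

text \<open>The Leibniz rule carries closure under differentiation from the generators to all
  polynomials in them, so only \<open>G\<close> has to be checked.\<close>

lemma gen_algebra_smooth:
  assumes "\<And>g. g \<in> G \<Longrightarrow> g differentiable_on UNIV"
    and "\<And>g b. g \<in> G \<Longrightarrow> b \<in> Basis \<Longrightarrow> dir_deriv b g \<in> gen_algebra G"
    and "f \<in> gen_algebra G"
  shows "smooth_fun f"
proof (rule smooth_fun_coinduct[OF assms(3)])
  have *: "g differentiable_on UNIV \<and> (\<forall>b\<in>Basis. dir_deriv b g \<in> gen_algebra G)"
    if "g \<in> gen_algebra G" for g
    using that
  proof induction
    case (gen g)
    then show ?case using assms(1,2) by auto
  next
    case (add f g)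
    have "dir_deriv b (\<lambda>x. f x + g x) = (\<lambda>x. dir_deriv b f x + dir_deriv b g x)" for b
      using add.IH by (intro ext dir_deriv_add) (auto simp: differentiable_on_def)
    then show ?case using add.IH by (auto intro!: gen_algebra.add differentiable_on_add)
  next
    case (mult f g)
    have "dir_deriv b (\<lambda>x. f x * g x) = (\<lambda>x. dir_deriv b f x * g x + f x * dir_deriv b g x)" for b
      using mult.IH by (intro ext dir_deriv_mult) (auto simp: differentiable_on_def)
    then show ?case using mult by (auto intro!: gen_algebra.add gen_algebra.mult differentiable_on_mult)
  qed
  show "g differentiable_on UNIV" if "g \<in> gen_algebra G" for g using * that by blast
  show "dir_deriv b g \<in> gen_algebra G" if "g \<in> gen_algebra G" "b \<in> Basis" for g b using * that by blast
qed

lemma gen_algebra_Collect_smooth: "f \<in> gen_algebra (Collect smooth_fun) \<Longrightarrow> smooth_fun f"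
  by (rule gen_algebra_smooth[where G="Collect smooth_fun"])
    (auto intro: gen_algebra.gen smooth_fun_dir_deriv smooth_fun_differentiable_on)

lemma smooth_fun_add: "smooth_fun f \<Longrightarrow> smooth_fun g \<Longrightarrow> smooth_fun (\<lambda>x. f x + g x)"
  by (rule gen_algebra_Collect_smooth) (auto intro: gen_algebra.intros)

lemma smooth_fun_mult: "smooth_fun f \<Longrightarrow> smooth_fun g \<Longrightarrow> smooth_fun (\<lambda>x. f x * g x)"
  by (rule gen_algebra_Collect_smooth) (auto intro: gen_algebra.intros)

lemma smooth_fun_const: "smooth_fun (\<lambda>x. c)"
proof (rule smooth_fun_coinduct[where X="range (\<lambda>c x. c)"])
  have "dir_deriv b (\<lambda>x::'a. c) = (\<lambda>x. 0)" for b c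
    by (rule ext, rule dir_deriv_eqI[where f'="\<lambda>_. 0"]) simp
  then show "dir_deriv b g \<in> range (\<lambda>c x. c)" if "g \<in> range (\<lambda>c x. c)" for g :: "'a \<Rightarrow> complex" and b
    using that by auto
qed auto

lemma smooth_fun_cmult: "smooth_fun f \<Longrightarrow> smooth_fun (\<lambda>x. c * f x)"
  by (intro smooth_fun_mult smooth_fun_const)

lemma smooth_fun_minus: "smooth_fun f \<Longrightarrow> smooth_fun (\<lambda>x. - f x)"
  using smooth_fun_cmult[of f "-1"] by simp

lemma smooth_fun_diff: "smooth_fun f \<Longrightarrow> smooth_fun g \<Longrightarrow> smooth_fun (\<lambda>x. f x - g x)"
  using smooth_fun_add[of f "\<lambda>x. - g x"] smooth_fun_minus by auto

lemma smooth_fun_sum: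
  "(\<And>i. i \<in> I \<Longrightarrow> smooth_fun (f i)) \<Longrightarrow> smooth_fun (\<lambda>x. \<Sum>i\<in>I. f i x)"
  by (induction I rule: infinite_finite_induct) (auto intro: smooth_fun_const smooth_fun_add)

lemma smooth_fun_prod:
  "(\<And>i. i \<in> I \<Longrightarrow> smooth_fun (f i)) \<Longrightarrow> smooth_fun (\<lambda>x. \<Prod>i\<in>I. f i x)"
  by (induction I rule: infinite_finite_induct) (auto intro: smooth_fun_const smooth_fun_mult)

lemma smooth_fun_bounded_linear:
  assumes "bounded_linear f"
  shows "smooth_fun f"
proof (rule smooth_fun_coinduct[where X="insert f (Collect smooth_fun)"])
  fix g b assume g: "g \<in> insert f (Collect smooth_fun)" "b \<in> (Basis::'a set)"
  have "dir_deriv b f = (\<lambda>x. f b)"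
    by (intro ext dir_deriv_eqI bounded_linear_imp_has_derivative assms)
  then show "dir_deriv b g \<in> insert f (Collect smooth_fun)"
    using g by (auto intro: smooth_fun_const smooth_fun_dir_deriv)
next
  fix g assume "g \<in> insert f (Collect smooth_fun)"
  then show "g differentiable_on UNIV"
    using assms by (auto intro: smooth_fun_differentiable_on bounded_linear_imp_differentiable_on)
qed simp

text \<open>The derivative of \<open>1/f\<close> is \<open>- Df * (1/f)\<^sup>2\<close>, a
  polynomial in \<open>1/f\<close> and smooth functions, so it suffices to adjoin \<open>1/f\<close>
  to the smooth functions.\<close>

lemma smooth_fun_inverse:
  assumes f: "smooth_fun f" and nz: "\<And>x. f x \<noteq> 0"
  shows "smooth_fun (\<lambda>x. inverse (f x))"
proof -
  let ?i = "\<lambda>x. inverse (f x)"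
  let ?G = "insert ?i (Collect smooth_fun)"
  have D: "(?i has_derivative (\<lambda>v. - (?i x * dir_deriv v f x * ?i x))) (at x)" for x
    by (rule Deriv.has_derivative_inverse[OF nz smooth_fun_has_derivative[OF f]])
  have eq: "dir_deriv b ?i = (\<lambda>x. (-1) * dir_deriv b f x * ?i x * ?i x)" for b
    by (rule ext) (simp add: dir_deriv_eqI[OF D] ac_simps)
  show ?thesis
  proof (rule gen_algebra_smooth[where G="?G"])
    fix g assume "g \<in> ?G"
    then show "g differentiable_on UNIV"
      using D smooth_fun_differentiable
      by (fastforce simp: differentiable_on_def differentiable_def)
  next
    fix g b assume g: "g \<in> ?G" and b: "b \<in> (Basis::'a set)"
    have "dir_deriv b ?i \<in> gen_algebra ?G"
      unfolding eq using f b
      by (intro gen_algebra.mult) (auto intro!: gen_algebra.gen smooth_fun_const smooth_fun_dir_deriv)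
    then show "dir_deriv b g \<in> gen_algebra ?G"
      using g b by (auto intro: gen_algebra.gen smooth_fun_dir_deriv)
  qed (auto intro: gen_algebra.gen)
qed

section \<open>Flat functions\<close>

text \<open>The factors \<open>x\<^sup>-\<^sup>n\<close> make the family closed under differentiation.\<close>

definition flat_exp :: "nat \<Rightarrow> real \<Rightarrow> real" where
  "flat_exp n x = (if 0 < x then exp (- (1 / x)) / x ^ n else 0)"

text \<open>On the right, \<open>y = 1/x\<close> turns the claim into the decay of
  \<open>y ^ n / exp y\<close> at infinity.\<close>

lemma flat_exp_tendsto_0: "(flat_exp n \<longlongrightarrow> 0) (at 0)"
proof -
  have "((\<lambda>x::real. x ^ n / exp x) \<longlongrightarrow> 0) at_top"
    by (rule tendsto_power_div_exp_0)
  then have "((\<lambda>x::real. (inverse x) ^ n / exp (inverse x)) \<longlongrightarrow> 0) (at_right 0)"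
    by (rule filterlim_compose) (rule filterlim_inverse_at_top_right)
  then have "(flat_exp n \<longlongrightarrow> 0) (at_right 0)"
    by (rule Lim_transform_eventually)
      (auto simp: eventually_at_filter flat_exp_def exp_minus field_simps)
  moreover have "(flat_exp n \<longlongrightarrow> 0) (at_left 0)"
    by (rule Lim_transform_eventually[OF tendsto_const])
      (auto simp: eventually_at_filter flat_exp_def)
  ultimately show ?thesis
    by (simp add: filterlim_split_at)
qed

lemma flat_exp_has_derivative:
  "(flat_exp n has_real_derivative (flat_exp (n + 2) x - n * flat_exp (n + 1) x)) (at x)"
proof -
  consider "x > 0" | "x < 0" | "x = 0" by linarith
  then show ?thesis
  proof cases
    case 1
    have pw: "m = 0 \<or> x ^ m = x * x ^ (m - Suc 0)" for m
      by (cases m) auto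
    have "((\<lambda>x. exp (- (1 / x)) / x ^ n) has_real_derivative
        (flat_exp (n + 2) x - n * flat_exp (n + 1) x)) (at x)"
      using 1 pw[of "n - 1"] by (cases n)
        (auto intro!: derivative_eq_intros simp: flat_exp_def field_simps power2_eq_square)
    then show ?thesis
      by (rule has_field_derivative_transform_within[where d=x]) (use 1 in \<open>auto simp: flat_exp_def dist_real_def\<close>)
  next
    case 2
    then have "((\<lambda>x. 0) has_real_derivative (flat_exp (n + 2) x - n * flat_exp (n + 1) x)) (at x)"
      by (simp add: flat_exp_def)
    then show ?thesis
      by (rule has_field_derivative_transform_within[where d="-x"]) (use 2 in \<open>auto simp: flat_exp_def dist_real_def\<close>)
  next
    case 3
    \<comment> \<open>The difference quotient of \<open>flat_exp n\<close> at 0 is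
      \<open>flat_exp (n + 1)\<close>, whose limit is already known.\<close>
    have "((\<lambda>h. (flat_exp n (0 + h) - flat_exp n 0) / h) \<longlongrightarrow> 0) (at 0)"
      by (rule Lim_transform_eventually[OF flat_exp_tendsto_0[of "Suc n"]])
        (auto simp: eventually_at_filter flat_exp_def)
    then show ?thesis
      using 3 by (simp add: DERIV_def flat_exp_def)
  qed
qed

text \<open>The chain rule raises the index \<open>n\<close> by one or two and multiplies by a
  derivative of \<open>p\<close>, so all indices have to be treated together as generators.\<close>

lemma smooth_fun_flat_exp:
  fixes p :: "'a::euclidean_space \<Rightarrow> real"
  assumes p: "smooth_fun (\<lambda>x. complex_of_real (p x))"
  shows "smooth_fun (\<lambda>x. complex_of_real (flat_exp n (p x)))"
proof -
  let ?p = "\<lambda>x. complex_of_real (p x)"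
  let ?E = "\<lambda>n x. complex_of_real (flat_exp n (p x))"
  let ?G = "range ?E \<union> Collect smooth_fun"
  have D: "(?E n has_derivative
      (\<lambda>v. (?E (n + 2) x + (- of_nat n) * ?E (n + 1) x) * dir_deriv v ?p x)) (at x)" for n x
  proof -
    have "(p has_derivative (\<lambda>v. Re (dir_deriv v ?p x))) (at x)"
      using has_derivative_Re[OF smooth_fun_has_derivative[OF p]] by simp
    then have "((\<lambda>x. flat_exp n (p x)) has_derivative (\<lambda>v. (flat_exp (n + 2) (p x) - n * flat_exp (n + 1) (p x)) * Re (dir_deriv v ?p x))) (at x)"
      using flat_exp_has_derivative[of n "p x"] unfolding has_field_derivative_def
      by (rule has_derivative_compose)
    then have "(?E n has_derivative (\<lambda>v. complex_of_real ((flat_exp (n + 2) (p x) - n * flat_exp (n + 1) (p x)) * Re (dir_deriv v ?p x)))) (at x)"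
      by (rule has_derivative_of_real)
    \<comment> \<open>A real-valued function has real directional derivatives; the detour is needed
      because smoothness is formulated for complex values.\<close>
    moreover have "complex_of_real (Re (dir_deriv v ?p x)) = dir_deriv v ?p x" for v
      using dir_deriv_eqI[OF has_derivative_of_real[OF \<open>(p has_derivative _) _\<close>], of v] by simp
    ultimately show ?thesis by simp
  qed
  show ?thesis
  proof (rule gen_algebra_smooth[where G="?G"])
    fix g assume "g \<in> ?G"
    then show "g differentiable_on UNIV"
      using D smooth_fun_differentiable
      by (fastforce simp: differentiable_on_def differentiable_def)
  next
    fix g b assume g: "g \<in> ?G" and b: "b \<in> (Basis::'a set)"
    have "dir_deriv b (?E n) = (\<lambda>x. (?E (n + 2) x + (- of_nat n) * ?E (n + 1) x) * dir_deriv b ?p x)" for n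
      by (rule ext) (rule dir_deriv_eqI[OF D])
    moreover have "(\<lambda>x. (?E (n + 2) x + (- of_nat n) * ?E (n + 1) x) * dir_deriv b ?p x) \<in> gen_algebra ?G" for n
      using smooth_fun_dir_deriv[OF p b]
      by (intro gen_algebra.mult gen_algebra.add) (auto intro!: gen_algebra.gen smooth_fun_const)
    ultimately have "dir_deriv b (?E n) \<in> gen_algebra ?G" for n by simp
    then show "dir_deriv b g \<in> gen_algebra ?G"
      using g b by (auto intro: gen_algebra.gen smooth_fun_dir_deriv)
  qed (auto intro: gen_algebra.gen)
qed

lemma flat_exp_nonneg: "0 \<le> flat_exp n x"
  by (simp add: flat_exp_def)

lemma flat_exp_pos_iff: "0 < flat_exp n x \<longleftrightarrow> 0 < x"
  by (simp add: flat_exp_def)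

lemma flat_exp_eq_0_iff: "flat_exp n x = 0 \<longleftrightarrow> x \<le> 0"
  by (simp add: flat_exp_def)

lemma smooth_fun_norm_power2:
  fixes a :: "'a::euclidean_space"
  shows "smooth_fun (\<lambda>x. complex_of_real ((norm (x - a))\<^sup>2))"
proof -
  have "smooth_fun (\<lambda>x. complex_of_real ((x - a) \<bullet> b))" for b :: 'a
  proof -
    have "smooth_fun (\<lambda>x::'a. complex_of_real (x \<bullet> b) - complex_of_real (a \<bullet> b))"
      by (intro smooth_fun_diff smooth_fun_const smooth_fun_bounded_linear
           bounded_linear_compose[OF bounded_linear_of_real] bounded_linear_inner_left)
    then show ?thesis by (simp add: inner_diff_left)
  qed
  then have "smooth_fun (\<lambda>x. \<Sum>b\<in>Basis. complex_of_real ((x - a) \<bullet> b) * complex_of_real ((x - a) \<bullet> b))"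
    by (intro smooth_fun_sum smooth_fun_mult)
  also have "(\<lambda>x. \<Sum>b\<in>Basis. complex_of_real ((x - a) \<bullet> b) * complex_of_real ((x - a) \<bullet> b)) = (\<lambda>x. complex_of_real ((norm (x - a))\<^sup>2))"
    by (rule ext) (simp add: power2_norm_eq_inner euclidean_inner[of "_ - _" "_ - _"])
  finally show ?thesis .
qed

section \<open>Supports, test functions and locality of derivatives\<close>

lemma fun_support_subset: "closed S \<Longrightarrow> (\<And>x. x \<notin> S \<Longrightarrow> f x = 0) \<Longrightarrow> fun_support f \<subseteq> S"
  unfolding fun_support_def by (intro closure_minimal) auto

lemma not_in_fun_support: "x \<notin> fun_support f \<Longrightarrow> f x = 0"
  unfolding fun_support_def using closure_subset[of "{x. f x \<noteq> 0}"] by auto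

lemma closed_fun_support: "closed (fun_support f)"
  by (simp add: fun_support_def)

lemma test_functionsI:
  assumes "smooth_fun f" "compact S" "S \<subseteq> \<Omega>" "\<And>x. x \<notin> S \<Longrightarrow> f x = 0"
  shows "f \<in> test_functions \<Omega>"
proof -
  have "fun_support f \<subseteq> S"
    using assms by (intro fun_support_subset) (auto intro: compact_imp_closed)
  then show ?thesis
    using assms closed_fun_support[of f] closed_Int_compact[of "fun_support f" S]
    by (auto simp: test_functions_def Int_absorb2)
qed

lemma test_functions_mult:
  assumes "f \<in> test_functions \<Omega>" "smooth_fun g"
  shows "(\<lambda>x. g x * f x) \<in> test_functions \<Omega>"
  using assms not_in_fun_support[of _ f]
  by (intro test_functionsI[where S="fun_support f"]) (auto simp: test_functions_def smooth_fun_mult)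

lemma test_functions_smooth: "f \<in> test_functions \<Omega> \<Longrightarrow> smooth_fun f"
  by (simp add: test_functions_def)

lemma test_functions_mono: "f \<in> test_functions A \<Longrightarrow> A \<subseteq> B \<Longrightarrow> f \<in> test_functions B"
  by (auto simp: test_functions_def)

text \<open>\<open>frechet_derivative\<close> is a choice among all derivatives at the point. Both
  functions have the same ones there, so the choices coincide, differentiable or not.\<close>

lemma dir_deriv_cong_open:
  assumes "open U" "x \<in> U" "\<And>y. y \<in> U \<Longrightarrow> f y = g y"
  shows "dir_deriv v f x = dir_deriv v g x"
proof -
  have "(f has_derivative D) (at x) \<longleftrightarrow> (g has_derivative D) (at x)" for D
    using has_derivative_transform_within_open[OF _ assms(1,2), of f D UNIV g]
      has_derivative_transform_within_open[OF _ assms(1,2), of g D UNIV f] assms(3) by auto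
  then show ?thesis unfolding dir_deriv_def frechet_derivative_def by simp
qed

lemma dir_deriv_const: "dir_deriv v (\<lambda>x. c) x = 0"
  by (rule dir_deriv_eqI[where f'="\<lambda>_. 0"]) simp

lemma dir_deriv_linear: "smooth_fun u \<Longrightarrow> linear (\<lambda>v. dir_deriv v u x)"
  using smooth_fun_has_derivative has_derivative_linear by blast

lemma dir_deriv_Basis:
  assumes "smooth_fun u"
  shows "dir_deriv v u z = (\<Sum>b\<in>Basis. (v \<bullet> b) *\<^sub>R dir_deriv b u z)"
proof -
  note l = dir_deriv_linear[OF assms, of z]
  have "dir_deriv v u z = dir_deriv (\<Sum>b\<in>Basis. (v \<bullet> b) *\<^sub>R b) u z"
    by (simp add: euclidean_representation)
  also have "\<dots> = (\<Sum>b\<in>Basis. (v \<bullet> b) *\<^sub>R dir_deriv b u z)"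
    by (simp only: linear_sum[OF l] linear_cmul[OF l])
  finally show ?thesis .
qed

text \<open>Smoothness speaks of basis directions, so a general direction \<open>v\<close> is
  expanded over \<open>Basis\<close>.\<close>

lemma dir_deriv_test_function:
  assumes u: "u \<in> test_functions \<Omega>"
  shows "dir_deriv v u \<in> test_functions \<Omega>"
proof -
  note s = test_functions_smooth[OF u]
  have eq: "dir_deriv v u = (\<lambda>z. \<Sum>b\<in>Basis. complex_of_real (v \<bullet> b) * dir_deriv b u z)"
    by (rule ext) (simp add: dir_deriv_Basis[OF s, of v] scaleR_conv_of_real)
  have sm: "smooth_fun (dir_deriv v u)"
    unfolding eq by (intro smooth_fun_sum smooth_fun_cmult smooth_fun_dir_deriv s)
  show ?thesis
  proof (rule test_functionsI[OF sm, where S="fun_support u"])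
    fix x assume "x \<notin> fun_support u"
    then have "dir_deriv v u x = dir_deriv v (\<lambda>_. 0) x"
      by (intro dir_deriv_cong_open[where U="- fun_support u"])
        (auto simp: closed_fun_support not_in_fun_support)
    then show "dir_deriv v u x = 0" by (simp add: dir_deriv_const)
  qed (use u in \<open>auto simp: test_functions_def\<close>)
qed

lemma axis_1_i_in_Basis: "axis j (1::complex) \<in> Basis" "axis j \<i> \<in> Basis"
  by (auto simp: axis_in_Basis_iff Basis_complex_def)

lemma smooth_fun_dzbar: "smooth_fun f \<Longrightarrow> smooth_fun (dzbar j f)"
proof -
  assume "smooth_fun f"
  then have "smooth_fun (\<lambda>z. (1/2) * (dir_deriv (axis j 1) f z + \<i> * dir_deriv (axis j \<i>) f z))"
    by (intro smooth_fun_cmult smooth_fun_add smooth_fun_dir_deriv axis_1_i_in_Basis)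
  then show ?thesis by (simp add: dzbar_def[abs_def])
qed

lemma dzbar_cong_open:
  assumes "open U" "x \<in> U" "\<And>y. y \<in> U \<Longrightarrow> f y = g y"
  shows "dzbar j f x = dzbar j g x"
  unfolding dzbar_def using dir_deriv_cong_open[OF assms] by simp

lemma dzbar_const: "dzbar j (\<lambda>x. c) x = 0"
  by (simp add: dzbar_def dir_deriv_const)

lemma dzbar_mult:
  assumes "smooth_fun f" "smooth_fun g"
  shows "dzbar j (\<lambda>x. f x * g x) x = dzbar j f x * g x + f x * dzbar j g x"
  unfolding dzbar_def
  by (simp add: dir_deriv_mult smooth_fun_differentiable assms field_simps)

lemma dzbar_outside_fun_support: "x \<notin> fun_support f \<Longrightarrow> dzbar j f x = 0"
  using dzbar_cong_open[of "- fun_support f" x f "\<lambda>_. 0" j] closed_fun_support[of f]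
  by (simp add: not_in_fun_support dzbar_const open_Compl)

lemma dzbar_test_function:
  "f \<in> test_functions \<Omega> \<Longrightarrow> dzbar j f \<in> test_functions \<Omega>"
  using dzbar_outside_fun_support
  by (intro test_functionsI[where S="fun_support f"])
    (auto simp: test_functions_def smooth_fun_dzbar)

lemma dir_deriv_translate:
  assumes "smooth_fun f"
  shows "dir_deriv v (\<lambda>x. f (x + a)) x = dir_deriv v f (x + a)"
proof -
  have "((\<lambda>x. x + a) has_derivative (\<lambda>v. v)) (at x)"
    by (auto intro!: derivative_eq_intros)
  from dir_deriv_eqI[OF has_derivative_compose[OF this smooth_fun_has_derivative[OF assms]]]
  show ?thesis .
qed

text \<open>The function is constant along the line through \<open>x\<close> in direction
  \<open>v\<close>, so the chain rule and uniqueness of the derivative apply. This serves functions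
  that ignore a coordinate.\<close>

lemma dir_deriv_invariant:
  assumes f: "smooth_fun f" and inv: "\<And>x (s::real). f (x + s *\<^sub>R v) = f x"
  shows "dir_deriv v f x = 0"
proof -
  have 1: "((\<lambda>s. x + s *\<^sub>R v) has_derivative (\<lambda>s. s *\<^sub>R v)) (at 0)"
    by (auto intro!: derivative_eq_intros)
  have "((\<lambda>s::real. f (x + s *\<^sub>R v)) has_derivative (\<lambda>s. dir_deriv (s *\<^sub>R v) f x)) (at 0)"
    using has_derivative_compose[OF 1, of f "\<lambda>w. dir_deriv w f x"] smooth_fun_has_derivative[OF f, of x]
    by simp
  then have "((\<lambda>s::real. f x) has_derivative (\<lambda>s. dir_deriv (s *\<^sub>R v) f x)) (at 0)"
    by (simp add: inv)
  then have "(\<lambda>s::real. dir_deriv (s *\<^sub>R v) f x) = (\<lambda>_. 0)"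
    by (rule has_derivative_unique) (rule has_derivative_const)
  then show ?thesis by (metis scaleR_one)
qed

text \<open>The support is defined by local vanishing, whereas \<phi> may spread over many of the
  small open sets. Compactness and a smooth partition of unity split \<phi> into finitely many
  pieces, each supported in a ball where \<open>T\<close> vanishes.\<close>

lemma distr_vanishes_off_support:
  assumes T: "distribution_on \<Omega> T" and \<phi>: "\<phi> \<in> test_functions \<Omega>"
    and disj: "fun_support \<phi> \<inter> distr_support \<Omega> T = {}"
  shows "T \<phi> = 0"
proof -
  let ?K = "fun_support \<phi>"
  have K: "compact ?K" "?K \<subseteq> \<Omega>" "smooth_fun \<phi>"
    using \<phi> by (auto simp: test_functions_def)
  have "\<exists>r>0. cball x r \<subseteq> \<Omega> \<and> (\<forall>\<psi>. \<psi> \<in> test_functions \<Omega> \<longrightarrow> fun_support \<psi> \<subseteq> cball x r \<longrightarrow> T \<psi> = 0)"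
    if "x \<in> ?K" for x
  proof -
    have "x \<in> \<Omega>" "x \<notin> distr_support \<Omega> T" using that disj K(2) by auto
    then obtain U where U: "open U" "x \<in> U" "U \<subseteq> \<Omega>" "\<And>\<phi>. \<phi> \<in> test_functions U \<Longrightarrow> T \<phi> = 0"
      by (auto simp: distr_support_def)
    then obtain r where "r > 0" "cball x r \<subseteq> U"
      using open_contains_cball by blast
    moreover have "\<psi> \<in> test_functions U" if "\<psi> \<in> test_functions \<Omega>" "fun_support \<psi> \<subseteq> cball x r" for \<psi>
      using that \<open>cball x r \<subseteq> U\<close> by (auto simp: test_functions_def)
    ultimately show ?thesis
      using U(3,4) by (intro exI[of _ r]) blast
  qed
  then have "\<exists>r. \<forall>x\<in>?K. r x > 0 \<and> cball x (r x) \<subseteq> \<Omega> \<and>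
      (\<forall>\<psi>. \<psi> \<in> test_functions \<Omega> \<longrightarrow> fun_support \<psi> \<subseteq> cball x (r x) \<longrightarrow> T \<psi> = 0)"
    by (intro bchoice) blast
  then obtain r where r: "\<And>x. x \<in> ?K \<Longrightarrow> r x > 0" "\<And>x. x \<in> ?K \<Longrightarrow> cball x (r x) \<subseteq> \<Omega>"
    "\<And>x \<psi>. x \<in> ?K \<Longrightarrow> \<psi> \<in> test_functions \<Omega> \<Longrightarrow> fun_support \<psi> \<subseteq> cball x (r x) \<Longrightarrow> T \<psi> = 0"
    by blast
  have "?K \<subseteq> (\<Union>x\<in>?K. ball x (r x))" using r(1) by force
  then obtain I where I: "I \<subseteq> ?K" "finite I" "?K \<subseteq> (\<Union>x\<in>I. ball x (r x))"
    by (rule compactE_image[OF K(1) open_ball])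
  \<comment> \<open>Unnormalised bumps: \<open>q a\<close> is positive exactly on the open ball of
    radius \<open>r a\<close> about \<open>a\<close>.\<close>
  define q where "q a x = flat_exp 0 ((r a)\<^sup>2 - (norm (x - a))\<^sup>2)" for a x
  define s where "s x = (\<Sum>a\<in>I. q a x)" for x
  have qs: "smooth_fun (\<lambda>x. complex_of_real (q a x))" for a
  proof -
    have "smooth_fun (\<lambda>x. complex_of_real ((r a)\<^sup>2) - complex_of_real ((norm (x - a))\<^sup>2))"
      by (intro smooth_fun_diff smooth_fun_const smooth_fun_norm_power2)
    then show ?thesis unfolding q_def by (intro smooth_fun_flat_exp) simp
  qed
  have q0: "0 \<le> q a x" for a x by (simp add: q_def flat_exp_nonneg)
  have qpos: "0 < q a x \<longleftrightarrow> x \<in> ball a (r a)" if "a \<in> I" for a x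
  proof -
    have "r a > 0" using that I r by auto
    then have "(norm (x - a))\<^sup>2 < (r a)\<^sup>2 \<longleftrightarrow> norm (x - a) < r a"
      using power_strict_mono[of "norm (x - a)" "r a" 2] power2_less_imp_less[of "norm (x - a)" "r a"]
      by auto
    then show ?thesis by (simp add: q_def flat_exp_pos_iff dist_norm norm_minus_commute)
  qed
  have ss: "smooth_fun (\<lambda>x. complex_of_real (s x))"
    unfolding s_def of_real_sum by (intro smooth_fun_sum qs)
  have s0: "0 \<le> s x" for x unfolding s_def by (intro sum_nonneg q0)
  have spos: "0 < s x" if x: "x \<in> ?K" for x
  proof -
    obtain a where a: "a \<in> I" "x \<in> ball a (r a)" using I x by auto
    then have "0 < q a x" using qpos by blast
    also have "q a x \<le> s x" unfolding s_def using a I q0 by (intro member_le_sum) auto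
    finally show ?thesis .
  qed
  have "\<exists>\<delta>>0. \<forall>x\<in>?K. \<delta> \<le> s x"
  proof (cases "?K = {}")
    case False
    have "continuous_on ?K s"
      using continuous_on_Re[OF smooth_fun_continuous_on[OF ss]] by simp
    then obtain x where "x \<in> ?K" "\<forall>y\<in>?K. s x \<le> s y"
      using continuous_attains_inf[OF K(1) False] by blast
    then show ?thesis using spos by blast
  qed (auto intro: exI[of _ 1])
  then obtain \<delta> where \<delta>: "\<delta> > 0" "\<And>x. x \<in> ?K \<Longrightarrow> \<delta> \<le> s x" by blast
  \<comment> \<open>\<open>d\<close> vanishes nowhere and agrees with \<open>s\<close> on the support of \<open>\<phi>\<close>, so the \<open>q a / d\<close> form a partition of unity there.\<close>
  define d where "d x = complex_of_real (s x) + complex_of_real (flat_exp 0 (\<delta> - s x))" for x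
  have ds: "smooth_fun d"
  proof -
    have "smooth_fun (\<lambda>x. complex_of_real \<delta> - complex_of_real (s x))"
      by (intro smooth_fun_diff smooth_fun_const ss)
    then have "smooth_fun (\<lambda>x. complex_of_real (flat_exp 0 (\<delta> - s x)))"
      by (intro smooth_fun_flat_exp) simp
    then show ?thesis unfolding d_def by (intro smooth_fun_add ss)
  qed
  have dnz: "d x \<noteq> 0" for x
  proof -
    \<comment> \<open>Where \<open>s\<close> vanishes, the flat term equals
      \<open>flat_exp 0 \<delta> > 0\<close>; elsewhere \<open>s\<close> itself is positive.\<close>
    have "0 < s x + flat_exp 0 (\<delta> - s x)"
      using s0[of x] \<delta>(1) flat_exp_nonneg[of 0 "\<delta> - s x"] flat_exp_pos_iff[of 0 "\<delta> - s x"]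
      by (cases "s x = 0") auto
    then show ?thesis unfolding d_def of_real_add[symmetric] of_real_eq_0_iff by simp
  qed
  define p where "p a x = complex_of_real (q a x) * (inverse (d x) * \<phi> x)" for a x
  have pt: "p a \<in> test_functions \<Omega>" for a
    unfolding p_def using dnz
    by (intro test_functions_mult \<phi> qs smooth_fun_inverse ds)
  have Tp: "T (p a) = 0" if "a \<in> I" for a
  proof (rule r(3)[OF _ pt])
    show "a \<in> ?K" using that I by auto
    show "fun_support (p a) \<subseteq> cball a (r a)"
    proof (rule fun_support_subset)
      fix x assume "x \<notin> cball a (r a)"
      then have "\<not> 0 < q a x" using qpos[OF that, of x] by auto
      then show "p a x = 0" using q0[of a x] by (simp add: p_def)
    qed simp
  qed
  have Tadd: "T (\<lambda>x. f x + g x) = T f + T g" if "f \<in> test_functions \<Omega>" "g \<in> test_functions \<Omega>" for f g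
    using conjunct1[OF T[unfolded distribution_on_def]] that by blast
  have "T (\<lambda>x. 0 * \<phi> x) = 0 * T \<phi>"
    using conjunct1[OF conjunct2[OF T[unfolded distribution_on_def]]] \<phi> by blast
  then have T0: "T (\<lambda>x. 0) = 0" by simp
  \<comment> \<open>Additivity is given for two test functions, so the induction must also keep the
    partial sums among the test functions.\<close>
  have "(\<lambda>x. \<Sum>a\<in>J. p a x) \<in> test_functions \<Omega> \<and> T (\<lambda>x. \<Sum>a\<in>J. p a x) = (\<Sum>a\<in>J. T (p a))"
    if "finite J" for J
    using that
  proof induction
    case empty
    show ?case using T0 by (auto intro: test_functionsI[where S="{}"] smooth_fun_const)
  next
    case (insert a J)
    have "(\<lambda>x. p a x + (\<Sum>a\<in>J. p a x)) \<in> test_functions \<Omega>"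
    proof (rule test_functionsI[OF _ K(1,2)])
      show "smooth_fun (\<lambda>x. p a x + (\<Sum>a\<in>J. p a x))"
        by (intro smooth_fun_add smooth_fun_sum test_functions_smooth[OF pt])
      show "p a x + (\<Sum>a\<in>J. p a x) = 0" if "x \<notin> ?K" for x
        using not_in_fun_support[OF that] by (simp add: p_def)
    qed
    then show ?case using insert Tadd[OF pt[of a], of "\<lambda>x. \<Sum>a\<in>J. p a x"] by simp
  qed
  from this[OF I(2)] have "T (\<lambda>x. \<Sum>a\<in>I. p a x) = 0" using Tp by simp
  moreover have "(\<Sum>a\<in>I. p a x) = \<phi> x" for x
  proof (cases "x \<in> ?K")
    case True
    then have "d x = complex_of_real (s x)"
      using \<delta>(2)[OF True] by (simp add: d_def flat_exp_def)
    moreover have "(\<Sum>a\<in>I. p a x) = complex_of_real (s x) * inverse (d x) * \<phi> x"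
      by (simp add: p_def s_def sum_distrib_right sum_distrib_left mult.assoc)
    ultimately show ?thesis using dnz[of x] by simp
  qed (simp add: p_def not_in_fun_support)
  ultimately show ?thesis by simp
qed

section \<open>Cutoffs in one coordinate\<close>

definition coord_cutoff :: "real \<Rightarrow> real \<Rightarrow> 'n::finite \<Rightarrow> complex^'n \<Rightarrow> complex" where
  "coord_cutoff a b j z =
     (let u = flat_exp 0 (b\<^sup>2 - (cmod (z $ j))\<^sup>2); v = flat_exp 0 ((cmod (z $ j))\<^sup>2 - a\<^sup>2)
      in complex_of_real u * inverse (complex_of_real (u + v)))"

lemma smooth_fun_coord_cmod_power2: "smooth_fun (\<lambda>z::complex^'n. complex_of_real ((cmod (z $ j))\<^sup>2))"
proof -
  have "smooth_fun (\<lambda>z::complex^'n. z $ j * cnj (z $ j))"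
    by (intro smooth_fun_mult smooth_fun_bounded_linear bounded_linear_vec_nth
        bounded_linear_compose[OF bounded_linear_cnj])
  then show ?thesis by (simp only: complex_norm_square)
qed

lemma open_coord_less: "open {z::complex^'n. cmod (z $ j) < c}"
  by (intro open_Collect_less continuous_intros)

lemma open_coord_greater: "open {z::complex^'n. c < cmod (z $ j)}"
  by (intro open_Collect_less continuous_intros)

context
  fixes a b :: real
  assumes ab: "0 < a" "a < b"
begin

text \<open>Squared moduli enter because the modulus is not smooth at 0. The two flat terms never
  vanish together, since \<open>a\<^sup>2 < b\<^sup>2\<close>, so the quotient is smooth.\<close>

lemma smooth_fun_coord_cutoff: "smooth_fun (coord_cutoff a b j)"
proof -
  have 1: "smooth_fun (\<lambda>z. complex_of_real (b\<^sup>2) - complex_of_real ((cmod (z $ j))\<^sup>2))"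
    by (intro smooth_fun_diff smooth_fun_const smooth_fun_coord_cmod_power2)
  have 2: "smooth_fun (\<lambda>z. complex_of_real ((cmod (z $ j))\<^sup>2) - complex_of_real (a\<^sup>2))"
    by (intro smooth_fun_diff smooth_fun_const smooth_fun_coord_cmod_power2)
  have "a\<^sup>2 < b\<^sup>2" using ab by (intro power_strict_mono) auto
  then have nz: "flat_exp 0 (b\<^sup>2 - t) + flat_exp 0 (t - a\<^sup>2) \<noteq> 0" for t
    using flat_exp_nonneg[of 0 "b\<^sup>2 - t"] flat_exp_nonneg[of 0 "t - a\<^sup>2"]
      flat_exp_eq_0_iff[of 0 "b\<^sup>2 - t"] flat_exp_eq_0_iff[of 0 "t - a\<^sup>2"] by linarith
  show ?thesis
    unfolding coord_cutoff_def Let_def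
  proof (intro smooth_fun_mult smooth_fun_inverse)
    show 3: "smooth_fun (\<lambda>x. complex_of_real (flat_exp 0 (b\<^sup>2 - (cmod (x $ j))\<^sup>2)))"
      using 1 by (intro smooth_fun_flat_exp) simp
    show "smooth_fun (\<lambda>x. complex_of_real (flat_exp 0 (b\<^sup>2 - (cmod (x $ j))\<^sup>2) + flat_exp 0 ((cmod (x $ j))\<^sup>2 - a\<^sup>2)))"
      unfolding of_real_add using 2 by (intro smooth_fun_add 3 smooth_fun_flat_exp) simp
    show "complex_of_real (flat_exp 0 (b\<^sup>2 - (cmod (x $ j))\<^sup>2) + flat_exp 0 ((cmod (x $ j))\<^sup>2 - a\<^sup>2)) \<noteq> 0" for x :: "complex^'a"
      unfolding of_real_eq_0_iff by (rule nz)
  qed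
qed

lemma coord_cutoff_eq_1: "cmod (z $ j) \<le> a \<Longrightarrow> coord_cutoff a b j z = 1"
proof -
  assume *: "cmod (z $ j) \<le> a"
  then have "(cmod (z $ j))\<^sup>2 \<le> a\<^sup>2" by (intro power_mono) auto
  moreover have "a\<^sup>2 < b\<^sup>2" using ab by (intro power_strict_mono) auto
  ultimately have "flat_exp 0 ((cmod (z $ j))\<^sup>2 - a\<^sup>2) = 0" "flat_exp 0 (b\<^sup>2 - (cmod (z $ j))\<^sup>2) \<noteq> 0"
    by (simp_all add: flat_exp_eq_0_iff)
  then show ?thesis by (simp add: coord_cutoff_def Let_def)
qed

lemma coord_cutoff_eq_0: "b \<le> cmod (z $ j) \<Longrightarrow> coord_cutoff a b j z = 0"
proof -
  assume "b \<le> cmod (z $ j)"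
  then have "b\<^sup>2 \<le> (cmod (z $ j))\<^sup>2" using ab by (intro power_mono) auto
  then show ?thesis by (simp add: coord_cutoff_def Let_def flat_exp_def)
qed

lemma dzbar_coord_cutoff_inner: "cmod (z $ j) < a \<Longrightarrow> dzbar i (coord_cutoff a b j) z = 0"
proof -
  assume "cmod (z $ j) < a"
  then have "dzbar i (coord_cutoff a b j) z = dzbar i (\<lambda>_. 1) z"
    by (intro dzbar_cong_open[OF open_coord_less[of j a]]) (auto simp: coord_cutoff_eq_1)
  then show ?thesis by (simp add: dzbar_const)
qed

lemma dzbar_coord_cutoff_outer: "b < cmod (z $ j) \<Longrightarrow> dzbar i (coord_cutoff a b j) z = 0"
proof -
  assume "b < cmod (z $ j)"
  then have "dzbar i (coord_cutoff a b j) z = dzbar i (\<lambda>_. 0) z"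
    by (intro dzbar_cong_open[OF open_coord_greater[of b j]]) (auto simp: coord_cutoff_eq_0)
  then show ?thesis by (simp add: dzbar_const)
qed

text \<open>The cutoff depends on \<open>z $ j\<close> only, hence so does its derivative.
  Multiplication by that derivative therefore preserves holomorphy in every other
  coordinate.\<close>

lemma dzbar_dzbar_coord_cutoff:
  assumes "i \<noteq> j"
  shows "dzbar i (dzbar j (coord_cutoff a b j)) z = 0"
proof -
  let ?c = "coord_cutoff a b j"
  have 1: "?c (z + s *\<^sub>R axis i w) = ?c z" for z s w
    using assms by (simp add: coord_cutoff_def axis_def)
  have 2: "dzbar j ?c (z + s *\<^sub>R axis i w) = dzbar j ?c z" for z s w
  proof -
    have "dir_deriv v ?c (z + s *\<^sub>R axis i w) = dir_deriv v ?c z" for v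
      using dir_deriv_translate[OF smooth_fun_coord_cutoff, of v j "s *\<^sub>R axis i w" z] by (simp add: 1)
    then show ?thesis by (simp add: dzbar_def)
  qed
  have "dir_deriv (axis i w) (dzbar j ?c) z = 0" for w
    by (intro dir_deriv_invariant smooth_fun_dzbar smooth_fun_coord_cutoff 2)
  then show ?thesis by (subst dzbar_def) simp
qed

end

section \<open>The Cauchy--Pompeiu formula\<close>

text \<open>\<open>f\<close> is dominated by the series of \<open>c n\<close> times the indicator of
  the disc of radius \<open>r n\<close>, whose integral is a multiple of the sum of
  \<open>c n * (r n)\<^sup>2\<close>. Dyadic radii then take the place of polar coordinates.\<close>

lemma integrable_if_bounded_on_discs:
  fixes f :: "complex \<Rightarrow> real" and c r :: "nat \<Rightarrow> real"
  assumes f[measurable]: "f \<in> borel_measurable borel" and f0: "\<And>t. 0 \<le> f t"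
    and cr: "\<And>n. 0 \<le> c n" "\<And>n. 0 \<le> r n" "summable (\<lambda>n. c n * (r n)\<^sup>2)"
    and bd: "\<And>t. f t \<noteq> 0 \<Longrightarrow> \<exists>n. cmod t \<le> r n \<and> f t \<le> c n"
  shows "integrable lborel f"
proof (rule integrableI_nonneg)
  let ?V = "unit_ball_vol (real DIM(complex))"
  have [measurable]: "cball (0::complex) (r n) \<in> sets borel" for n by simp
  have le: "ennreal (f t) \<le> (\<Sum>n. ennreal (c n) * indicator (cball 0 (r n)) t)" for t
  proof (cases "f t = 0")
    case False
    then obtain n where n: "cmod t \<le> r n" "f t \<le> c n" using bd by blast
    define g where "g n = ennreal (c n) * indicator (cball 0 (r n)) t" for n
    have "ennreal (f t) \<le> g n"
      using n by (simp add: g_def indicator_def ennreal_leI)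
    also have "\<dots> \<le> (\<Sum>n. g n)"
      using sum_le_suminf[of g "{n}"] by simp
    finally show ?thesis by (simp add: g_def)
  qed simp
  have "(\<integral>\<^sup>+t. ennreal (f t) \<partial>lborel) \<le> (\<integral>\<^sup>+t. (\<Sum>n. ennreal (c n) * indicator (cball (0::complex) (r n)) t) \<partial>lborel)"
    by (intro nn_integral_mono le)
  also have "\<dots> = (\<Sum>n. \<integral>\<^sup>+t. ennreal (c n) * indicator (cball (0::complex) (r n)) t \<partial>lborel)"
    by (intro nn_integral_suminf) measurable
  also have "\<dots> = (\<Sum>n. ennreal (?V * (c n * (r n)\<^sup>2)))"
  proof (rule suminf_cong)
    fix n
    have "(\<integral>\<^sup>+t. ennreal (c n) * indicator (cball (0::complex) (r n)) t \<partial>lborel)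
      = ennreal (c n) * ennreal (?V * (r n)\<^sup>2)"
      using emeasure_cball[OF cr(2)[of n], of "0::complex"]
      by (subst nn_integral_cmult_indicator) auto
    also have "\<dots> = ennreal (?V * (c n * (r n)\<^sup>2))"
      by (subst ennreal_mult[symmetric]) (auto simp: cr ac_simps intro!: mult_nonneg_nonneg)
    finally show "(\<integral>\<^sup>+t. ennreal (c n) * indicator (cball (0::complex) (r n)) t \<partial>lborel) = ennreal (?V * (c n * (r n)\<^sup>2))" .
  qed
  also have "\<dots> = ennreal (\<Sum>n. ?V * (c n * (r n)\<^sup>2))"
    by (rule suminf_ennreal2) (auto simp: cr intro!: mult_nonneg_nonneg summable_mult)
  also have "\<dots> < \<infinity>" by simp
  finally show "(\<integral>\<^sup>+t. ennreal (f t) \<partial>lborel) < \<infinity>" .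
qed (auto simp: f0)

text \<open>On the shell \<open>3 / 2 ^ Suc n < cmod t \<le> 3 / 2 ^ n\<close> the value is at most
  \<open>2 ^ Suc n / 3\<close>; times the squared radius this is \<open>6 / 2 ^ n\<close>. At the
  origin the value is 0, because \<open>inverse 0 = 0\<close>.\<close>

lemma integrable_inverse_cmod: "integrable lborel (\<lambda>t. indicator (cball 0 3) t * inverse (cmod t))"
proof (rule integrable_if_bounded_on_discs[where c="\<lambda>n. 2 ^ Suc n / 3" and r="\<lambda>n. 3 / 2 ^ n"])
  have [measurable]: "cball (0::complex) 3 \<in> sets borel" by simp
  show "(\<lambda>t. indicat_real (cball 0 3) t * inverse (cmod t)) \<in> borel_measurable borel" by measurable
  have "(\<lambda>n. 2 ^ Suc n / 3 * (3 / 2 ^ n)\<^sup>2) = (\<lambda>n. 6 * (1/2::real) ^ n)"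
    by (rule ext) (simp add: power2_eq_square field_simps)
  then show "summable (\<lambda>n. 2 ^ Suc n / 3 * (3 / 2 ^ n::real)\<^sup>2)"
    by (simp only:) (intro summable_mult summable_geometric, simp)
  fix t :: complex assume "indicator (cball 0 3) t * inverse (cmod t) \<noteq> 0"
  then have t: "t \<noteq> 0" "cmod t \<le> 3" by (auto simp: indicator_def split: if_splits)
  have ex: "\<exists>m. 3 / 2 ^ m < cmod t"
  proof -
    obtain m where "3 / cmod t < 2 ^ m" using real_arch_pow[of 2 "3 / cmod t"] by auto
    with t show ?thesis by (intro exI[of _ m]) (simp add: field_simps)
  qed
  \<comment> \<open>The least such \<open>m\<close> is positive because
    \<open>cmod t \<le> 3\<close>; its predecessor is the index of the shell containing
    \<open>t\<close>.\<close>
  define m where "m = (LEAST m. 3 / 2 ^ m < cmod t)"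
  have m: "3 / 2 ^ m < cmod t" unfolding m_def by (rule LeastI_ex[OF ex])
  then obtain n where n: "m = Suc n" using t by (cases m) auto
  then have "cmod t \<le> 3 / 2 ^ n"
    using not_less_Least[of n "\<lambda>m. 3 / 2 ^ m < cmod t"] unfolding m_def[symmetric] by auto
  moreover have "inverse (cmod t) \<le> 2 ^ Suc n / 3"
    using m n t by (simp add: field_simps)
  ultimately show "\<exists>n. cmod t \<le> 3 / 2 ^ n \<and> indicator (cball 0 3) t * inverse (cmod t) \<le> 2 ^ Suc n / 3"
    using t by (intro exI[of _ n]) (simp add: indicator_def)
qed auto

text \<open>For \<open>n > 0\<close> and \<open>2 ^ (n - 1) \<le> cmod t\<close> the value is at
  most \<open>16 * (1/16) ^ n\<close>; times the squared radius this is \<open>16 / 4 ^ n\<close>.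
  The factor 16 absorbs the shift of the index by one.\<close>

lemma integrable_inverse_quartic: "integrable lborel (\<lambda>t::complex. inverse ((1 + (cmod t)\<^sup>2)\<^sup>2))"
proof (rule integrable_if_bounded_on_discs[where c="\<lambda>n. 16 * (1/16) ^ n" and r="\<lambda>n. 2 ^ n"])
  have "(\<lambda>n. 16 * (1/16) ^ n * (2 ^ n)\<^sup>2) = (\<lambda>n. 16 * (1/4::real) ^ n)"
    by (rule ext) (simp add: power2_eq_square power_mult_distrib[symmetric] mult.assoc)
  then show "summable (\<lambda>n. 16 * (1/16) ^ n * (2 ^ n::real)\<^sup>2)"
    by (simp only:) (intro summable_mult summable_geometric, simp)
  fix t :: complex
  have ex: "\<exists>m. cmod t < 2 ^ m" using real_arch_pow[of 2 "cmod t"] by auto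
  define m where "m = (LEAST m. cmod t < 2 ^ m)"
  have m: "cmod t < 2 ^ m" unfolding m_def by (rule LeastI_ex[OF ex])
  have "inverse ((1 + (cmod t)\<^sup>2)\<^sup>2) \<le> 16 * (1/16) ^ m"
  proof (cases m)
    case 0
    have "1 \<le> (1 + (cmod t)\<^sup>2)\<^sup>2" by (intro one_le_power) simp
    then have "inverse ((1 + (cmod t)\<^sup>2)\<^sup>2) \<le> 1" by (intro inverse_le_1_iff[THEN iffD2]) auto
    then show ?thesis using 0 by simp
  next
    case (Suc n)
    then have "2 ^ n \<le> cmod t"
      using not_less_Least[of n "\<lambda>m. cmod t < 2 ^ m"] unfolding m_def[symmetric] by auto
    then have "(2 ^ n)\<^sup>2 \<le> (cmod t)\<^sup>2" by (intro power_mono) auto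
    then have "(2 ^ n)\<^sup>2 \<le> 1 + (cmod t)\<^sup>2" by linarith
    then have "((2 ^ n)\<^sup>2)\<^sup>2 \<le> (1 + (cmod t)\<^sup>2)\<^sup>2" by (intro power_mono) auto
    moreover have "((2 ^ n)\<^sup>2)\<^sup>2 = (16::real) ^ n"
      by (simp add: power_mult[symmetric] mult.commute[of n]) (simp add: power_mult)
    ultimately have "inverse ((1 + (cmod t)\<^sup>2)\<^sup>2) \<le> inverse (16 ^ n)"
      by (intro le_imp_inverse_le) auto
    then show ?thesis using Suc by (simp add: power_one_over inverse_eq_divide)
  qed
  then show "\<exists>n. cmod t \<le> 2 ^ n \<and> inverse ((1 + (cmod t)\<^sup>2)\<^sup>2) \<le> 16 * (1/16) ^ n"
    using m by (intro exI[of _ m]) auto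
qed auto

text \<open>The total mass of the approximate identity behind the Cauchy--Pompeiu formula. It
  normalises the kernel and reappears in the limit, where it cancels, so positivity is the only
  information about it that is used.\<close>

definition kernel_mass :: real where
  "kernel_mass = (LINT t|lborel. inverse ((1 + (cmod t)\<^sup>2)\<^sup>2))"

lemma kernel_mass_pos: "0 < kernel_mass"
proof -
  have "kernel_mass \<noteq> 0"
  proof
    assume "kernel_mass = 0"
    then have "AE t in lborel. inverse ((1 + (cmod t)\<^sup>2)\<^sup>2) = 0"
      using integral_nonneg_eq_0_iff_AE[OF integrable_inverse_quartic] by (simp add: kernel_mass_def)
    moreover have "inverse ((1 + (cmod t)\<^sup>2)\<^sup>2) \<noteq> 0" for t
      by (smt (verit) inverse_nonzero_iff_nonzero power_eq_0_iff zero_le_power2)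
    ultimately have "AE t in (lborel :: complex measure). False" by simp
    then show False by (simp add: eventually_False ae_filter_eq_bot_iff)
  qed
  moreover have "0 \<le> kernel_mass" unfolding kernel_mass_def by (intro integral_nonneg_AE) auto
  ultimately show ?thesis by simp
qed

text \<open>In fact \<^const>\<open>kernel_mass\<close> is \<open>\<pi>\<close>.  The truncation at radius 3 makes
  the kernel integrable and is harmless for points of the unit disc.\<close>

definition cauchy_kernel :: "complex \<Rightarrow> complex" where
  "cauchy_kernel t = indicator (cball 0 3) t * inverse (complex_of_real kernel_mass * t)"

lemma cauchy_kernel_measurable [measurable]: "cauchy_kernel \<in> borel_measurable borel"
proof -
  have [measurable]: "cball (0::complex) 3 \<in> sets borel" by simp
  show ?thesis unfolding cauchy_kernel_def by measurable
qed

lemma cauchy_kernel_outside: "3 < cmod t \<Longrightarrow> cauchy_kernel t = 0"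
  by (simp add: cauchy_kernel_def)

lemma integrable_cauchy_kernel: "integrable lborel cauchy_kernel"
proof (rule Bochner_Integration.integrable_bound)
  show "integrable lborel (\<lambda>t. inverse kernel_mass * (indicator (cball 0 3) t * inverse (cmod t)))"
    by (intro integrable_mult_right integrable_inverse_cmod)
  show "AE t in lborel. norm (cauchy_kernel t)
      \<le> norm (inverse kernel_mass * (indicator (cball 0 3) t * inverse (cmod t)))"
    using kernel_mass_pos
    by (auto simp: cauchy_kernel_def norm_mult norm_inverse indicator_def)
qed simp

section \<open>Translations, dilations and integrals of derivatives\<close>

lemma lborel_integral_translate:
  fixes f :: "'a::euclidean_space \<Rightarrow> 'b::{banach, second_countable_topology}"
  assumes [measurable]: "f \<in> borel_measurable borel"
  shows "(LINT x|lborel. f (x + a)) = (LINT x|lborel. f x)"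
proof -
  have "(LINT x|lborel. f x) = (LINT x|distr lborel borel ((+) a). f x)"
    by (simp add: lborel_distr_plus)
  also have "\<dots> = (LINT x|lborel. f (a + x))" by (rule integral_distr) auto
  finally show ?thesis by (simp add: add.commute)
qed

lemma lborel_integrable_translate:
  fixes f :: "'a::euclidean_space \<Rightarrow> 'b::{banach, second_countable_topology}"
  assumes "integrable lborel f"
  shows "integrable lborel (\<lambda>x. f (x + a))"
proof -
  have "integrable (distr lborel borel ((+) a)) f" using assms by (simp add: lborel_distr_plus)
  then have "integrable lborel (\<lambda>x. f (a + x))" by (rule integrable_distr[rotated]) auto
  then show ?thesis by (simp add: add.commute)
qed

lemma lborel_integral_scale:
  fixes f :: "'a::euclidean_space \<Rightarrow> 'b::{banach, second_countable_topology}"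
  assumes [measurable]: "f \<in> borel_measurable borel" and c: "c \<noteq> 0"
  shows "(LINT x|lborel. f x) = (LINT x|lborel. \<bar>c\<bar> ^ DIM('a) *\<^sub>R f (c *\<^sub>R x))"
proof -
  have "(LINT x|lborel. f x)
      = (LINT x|density (distr lborel borel (\<lambda>x. 0 + c *\<^sub>R x)) (\<lambda>_. \<bar>c\<bar> ^ DIM('a)). f x)"
    using lborel_affine[OF c, of "0::'a"] by simp
  also have "\<dots> = (LINT x|distr lborel borel (\<lambda>x. 0 + c *\<^sub>R x). \<bar>c\<bar> ^ DIM('a) *\<^sub>R f x)"
    by (rule integral_density) auto
  also have "\<dots> = (LINT x|lborel. \<bar>c\<bar> ^ DIM('a) *\<^sub>R f (0 + c *\<^sub>R x))"
    by (rule integral_distr) auto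
  finally show ?thesis by simp
qed

lemma integrable_continuous_bounded_support:
  fixes f :: "'a::euclidean_space \<Rightarrow> complex"
  assumes "continuous_on UNIV f" "\<And>x. R < norm x \<Longrightarrow> f x = 0"
  shows "integrable lborel f"
proof -
  have "integrable lborel (\<lambda>x. indicator (cball 0 R) x *\<^sub>R f x)"
    using assms(1) by (intro borel_integrable_compact) (auto intro: continuous_on_subset)
  also have "(\<lambda>x. indicator (cball 0 R) x *\<^sub>R f x) = f"
    using assms(2) by (auto simp: indicator_def not_le fun_eq_iff)
  finally show ?thesis .
qed

lemma bounded_continuous_bounded_support:
  fixes f :: "'a::euclidean_space \<Rightarrow> complex"
  assumes "continuous_on UNIV f" "\<And>x. R < norm x \<Longrightarrow> f x = 0"
  obtains M where "0 \<le> M" "\<And>x. cmod (f x) \<le> M"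
proof -
  have "bounded (f ` cball 0 R)"
    using assms(1) by (intro compact_imp_bounded compact_continuous_image) (auto intro: continuous_on_subset)
  then obtain M where "\<And>x. norm x \<le> R \<Longrightarrow> cmod (f x) \<le> M"
    unfolding bounded_iff by (metis imageI mem_cball_0)
  then have "cmod (f x) \<le> max 0 M" for x
    using assms(2)[of x] by (cases "norm x \<le> R") (auto simp: le_max_iff_disj)
  then show ?thesis using that[of "max 0 M"] by auto
qed

lemma has_derivative_zero_outside:
  assumes "(F has_derivative D) (at x)" "\<And>x. R < norm x \<Longrightarrow> F x = 0" "R < norm x"
  shows "D v = 0"
proof -
  have "((\<lambda>_. 0) has_derivative D) (at x)"
    by (rule has_derivative_transform_within_open[OF assms(1), where s="{x. R < norm x}"])
      (use assms in \<open>auto intro!: open_Collect_less continuous_intros\<close>)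
  then have "D = (\<lambda>_. 0)"
    by (rule has_derivative_unique) (rule has_derivative_const)
  then show ?thesis by simp
qed

text \<open>The integral of a difference quotient vanishes by translation invariance.\<close>

lemma integral_derivative_eq_0:
  fixes F :: "'a::euclidean_space \<Rightarrow> complex"
  assumes der: "\<And>x. (F has_derivative F' x) (at x)"
    and cont: "continuous_on UNIV (\<lambda>x. F' x v)"
    and zero: "\<And>x. R < norm x \<Longrightarrow> F x = 0"
  shows "(LINT x|lborel. F' x v) = 0"
proof -
  have zero': "F' x v = 0" if "R < norm x" for x
    using has_derivative_zero_outside[OF der zero that] .
  obtain M where M: "0 \<le> M" "\<And>x. cmod (F' x v) \<le> M"
    using bounded_continuous_bounded_support[OF cont zero'] by blast
  have contF: "continuous_on UNIV F"
    by (intro continuous_at_imp_continuous_on ballI has_derivative_continuous[OF der])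
  have intF: "integrable lborel F"
    by (rule integrable_continuous_bounded_support[OF contF zero])
  have [measurable]: "F \<in> borel_measurable borel" "(\<lambda>x. F' x v) \<in> borel_measurable borel"
    using contF cont by (auto intro: borel_measurable_continuous_onI)
  define e where "e n = 1 / real (Suc n)" for n
  have e: "0 < e n" "e n \<le> 1" for n by (auto simp: e_def)
  define s where "s n x = (F (x + e n *\<^sub>R v) - F x) /\<^sub>R e n" for n x
  have line: "((\<lambda>h::real. F (x + h *\<^sub>R v)) has_derivative (\<lambda>h. F' (x + u *\<^sub>R v) (h *\<^sub>R v))) (at u within S)" for x u S
  proof -
    have "((\<lambda>h. x + h *\<^sub>R v) has_derivative (\<lambda>h. h *\<^sub>R v)) (at u within S)"
      by (auto intro!: derivative_eq_intros)
    from has_derivative_compose[OF this der] show ?thesis .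
  qed
  have lin: "F' x (h *\<^sub>R v) = h *\<^sub>R F' x v" for x h
    using has_derivative_bounded_linear[OF der] by (simp add: linear_simps)
  \<comment> \<open>The mean value inequality along the segment bounds the difference quotient by
    the derivative in direction \<open>v\<close>, uniformly in \<open>n\<close>.\<close>
  have sb: "cmod (s n x) \<le> M" for n x
  proof -
    have "norm (F (x + e n *\<^sub>R v) - F (x + 0 *\<^sub>R v)) \<le> M * norm (e n - 0)"
    proof (rule differentiable_bound[where S="{0..e n}" and f="\<lambda>h. F (x + h *\<^sub>R v)"
          and f'="\<lambda>u h. F' (x + u *\<^sub>R v) (h *\<^sub>R v)"])
      show "((\<lambda>h. F (x + h *\<^sub>R v)) has_derivative (\<lambda>h. F' (x + u *\<^sub>R v) (h *\<^sub>R v))) (at u within {0..e n})" for u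
        by (rule line)
      show "onorm (\<lambda>h. F' (x + u *\<^sub>R v) (h *\<^sub>R v)) \<le> M" for u
        by (rule onorm_bound) (use M in \<open>auto simp: lin mult.commute[of M] intro: mult_left_mono\<close>)
    qed (use e[of n] in auto)
    moreover have "cmod (s n x) = cmod (F (x + e n *\<^sub>R v) - F x) / e n"
      using e[of n] by (simp add: s_def divide_inverse mult.commute)
    ultimately show ?thesis using e[of n] by (simp add: pos_divide_le_eq)
  qed
  \<comment> \<open>As \<open>e n \<le> 1\<close>, the translation moves points by at most
    \<open>norm v\<close>. This gives one bounded set carrying all quotients, and so an integrable
    majorant.\<close>
  have s0: "s n x = 0" if "R + norm v < norm x" for n x
  proof -
    have "norm (e n *\<^sub>R v) \<le> norm v" using e[of n] by (simp add: mult_left_le_one_le)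
    moreover have "norm x \<le> norm (x + e n *\<^sub>R v) + norm (e n *\<^sub>R v)"
      using norm_triangle_ineq4[of "x + e n *\<^sub>R v" "e n *\<^sub>R v"] by simp
    ultimately have "R < norm (x + e n *\<^sub>R v)" using that by linarith
    moreover have "R < norm x" using that norm_ge_zero[of v] by linarith
    ultimately show ?thesis by (simp add: s_def zero)
  qed
  have "(\<lambda>n. LINT x|lborel. s n x) \<longlonglongrightarrow> (LINT x|lborel. F' x v)"
  proof (rule integral_dominated_convergence[where w="\<lambda>x. M * indicator (cball 0 (R + norm v)) x"])
    show "integrable lborel (\<lambda>x::'a. M * indicator (cball 0 (R + norm v)) x)"
      using emeasure_bounded_finite[OF bounded_cball[of "0::'a" "R + norm v"]]
      by (intro integrable_mult_right integrable_real_indicator) auto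
    show "AE x in lborel. (\<lambda>n. s n x) \<longlonglongrightarrow> F' x v"
    proof (rule AE_I2)
      fix x
      have "((\<lambda>h. norm (F (x + h *\<^sub>R v) - F x - h *\<^sub>R F' x v) / norm h) \<longlongrightarrow> 0) (at 0)"
        using line[of x 0 UNIV] by (simp add: has_derivative_at lin)
      then have "((\<lambda>h::real. norm ((F (x + h *\<^sub>R v) - F x) /\<^sub>R h - F' x v)) \<longlongrightarrow> 0) (at 0)"
      proof (rule Lim_transform_eventually)
        have "norm (F (x + h *\<^sub>R v) - F x - h *\<^sub>R F' x v) / norm h = norm ((F (x + h *\<^sub>R v) - F x) /\<^sub>R h - F' x v)"
          if "h \<noteq> 0" for h
        proof -
          have eq: "(F (x + h *\<^sub>R v) - F x) /\<^sub>R h - F' x v = (F (x + h *\<^sub>R v) - F x - h *\<^sub>R F' x v) /\<^sub>R h"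
            by (simp only: scaleR_diff_right scaleR_scaleR left_inverse[OF that] scaleR_one)
          show ?thesis unfolding eq norm_scaleR real_norm_def by (simp only: abs_inverse divide_inverse mult.commute)
        qed
        then show "\<forall>\<^sub>F h in at 0. norm (F (x + h *\<^sub>R v) - F x - h *\<^sub>R F' x v) / norm h = norm ((F (x + h *\<^sub>R v) - F x) /\<^sub>R h - F' x v)"
          using eventually_neq_at_within[of "0::real" 0 UNIV] by (rule eventually_mono[rotated])
      qed
      then have "((\<lambda>h::real. (F (x + h *\<^sub>R v) - F x) /\<^sub>R h) \<longlongrightarrow> F' x v) (at 0)"
        by (rule LIM_zero_cancel[OF tendsto_norm_zero_cancel])
      moreover have "filterlim e (at 0) sequentially"
        unfolding filterlim_at e_def using LIMSEQ_Suc[OF lim_1_over_n] by auto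
      ultimately show "(\<lambda>n. s n x) \<longlonglongrightarrow> F' x v"
        unfolding s_def by (rule filterlim_compose)
    qed
    show "AE x in lborel. norm (s n x) \<le> M * indicator (cball 0 (R + norm v)) x" for n
      using sb[of n] s0[of _ n] by (intro AE_I2) (auto simp: indicator_def not_le)
  qed (auto simp: s_def)
  moreover have "(LINT x|lborel. s n x) = 0" for n
    unfolding s_def using intF lborel_integrable_translate[OF intF] lborel_integral_translate[of F]
    by simp
  ultimately show ?thesis by (simp add: LIMSEQ_const_iff)
qed


text \<open>The kernel \<open>1/t\<close> is regularised to \<open>t\<^sup>-/(\<bar>t\<bar>\<^sup>2 + \<epsilon>\<^sup>2)\<close>, whose \<open>\<partial>\<^sup>-\<close> is \<open>\<epsilon>\<^sup>2/(\<bar>t\<bar>\<^sup>2 + \<epsilon>\<^sup>2)\<^sup>2\<close>, an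
  approximate identity of total mass \<^const>\<open>kernel_mass\<close>.\<close>

theorem cauchy_pompeiu:
  fixes w :: "complex \<Rightarrow> complex"
  assumes der: "\<And>t. (w has_derivative w' t) (at t)"
    and cont: "continuous_on UNIV (\<lambda>t. w' t 1)" "continuous_on UNIV (\<lambda>t. w' t \<i>)"
    and zero: "\<And>t. 3 < cmod t \<Longrightarrow> w t = 0"
  shows "(LINT t|lborel. cauchy_kernel t * ((w' t 1 + \<i> * w' t \<i>) / 2)) = - w 0"
proof -
  define D where "D t = (w' t 1 + \<i> * w' t \<i>) / 2" for t
  have contw: "continuous_on A w" for A
    by (intro continuous_at_imp_continuous_on ballI has_derivative_continuous[OF der])
  have contD: "continuous_on UNIV D"
    unfolding D_def by (intro continuous_intros cont) auto
  have zero': "w' t v = 0" if "3 < cmod t" for t v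
    using has_derivative_zero_outside[OF der zero that] .
  then have zeroD: "D t = 0" if "3 < cmod t" for t using that by (simp add: D_def)
  have [measurable]: "w \<in> borel_measurable borel" "D \<in> borel_measurable borel"
    using contw contD by (auto intro: borel_measurable_continuous_onI)
  obtain M where M: "0 \<le> M" "\<And>t. cmod (D t) \<le> M"
    using bounded_continuous_bounded_support[OF contD zeroD] by blast
  obtain W where W: "0 \<le> W" "\<And>t. cmod (w t) \<le> W"
    using bounded_continuous_bounded_support[OF contw zero] by blast
  define e where "e n = 1 / real (Suc n)" for n
  have e: "0 < e n" for n by (auto simp: e_def)
  have e0: "e \<longlonglongrightarrow> 0" unfolding e_def using LIMSEQ_Suc[OF lim_1_over_n] by simp
  define q where "q n t = t * cnj t + (complex_of_real (e n))\<^sup>2" for n t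
  have q: "q n t = complex_of_real ((cmod t)\<^sup>2 + (e n)\<^sup>2)" for n t
    unfolding q_def of_real_add complex_norm_square by simp
  have qpos: "0 < (cmod t)\<^sup>2 + (e n)\<^sup>2" for n t using e[of n] by (simp add: add_nonneg_pos)
  have qnz: "q n t \<noteq> 0" for n t
    unfolding q of_real_eq_0_iff using qpos[of t n] by (rule less_imp_neq[symmetric])
  define k where "k n t = cnj t / q n t" for n t
  have qcont: "continuous_on UNIV (q n)" for n unfolding q_def by (intro continuous_intros)
  have kcont: "continuous_on UNIV (k n)" for n
    unfolding k_def using qnz by (intro continuous_intros qcont) auto
  define k' where "k' n t v = (cnj v * q n t - cnj t * (v * cnj t + t * cnj v)) / (q n t)\<^sup>2" for n t v
  have qder: "(q n has_derivative (\<lambda>v. v * cnj t + t * cnj v)) (at t)" for n t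
    unfolding q_def by (auto intro!: derivative_eq_intros)
  have kder: "(k n has_derivative k' n t) (at t)" for n t
    unfolding k_def k'_def[abs_def]
    by (rule has_derivative_eq_rhs[OF has_derivative_divide[OF has_derivative_cnj[OF has_derivative_ident] qder qnz]])
      (use qnz[of n t] in \<open>auto simp: fun_eq_iff field_simps power2_eq_square\<close>)
  \<comment> \<open>The numerator reduces to \<open>q n t - t * cnj t\<close>, which is
    \<open>(e n)\<^sup>2\<close>.\<close>
  have k'sum: "(k' n t 1 + \<i> * k' n t \<i>) / 2 = (complex_of_real (e n))\<^sup>2 / (q n t)\<^sup>2" for n t
  proof -
    have "\<i> * (\<i> * z) = - z" for z by (simp add: mult.assoc[symmetric])
    then have "k' n t 1 + \<i> * k' n t \<i> = 2 * (q n t - t * cnj t) / (q n t)\<^sup>2"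
      unfolding k'_def by (simp add: add_divide_distrib[symmetric] algebra_simps)
    then show ?thesis by (simp add: q_def)
  qed
  have k'cont: "continuous_on UNIV (\<lambda>t. k' n t v)" for n v
    unfolding k'_def using qnz by (intro continuous_intros qcont) auto
  \<comment> \<open>Integration by parts: the real partial derivatives of \<open>k n * w\<close>
    have integral 0, and the directions \<open>1\<close> and \<open>\<i>\<close> are
    combined.\<close>
  have parts: "(LINT t|lborel. k n t * D t) = - (LINT t|lborel. (complex_of_real (e n))\<^sup>2 / (q n t)\<^sup>2 * w t)" for n
  proof -
    have d: "((\<lambda>t. k n t * w t) has_derivative (\<lambda>v. k n t * w' t v + k' n t v * w t)) (at t)" for t
      by (rule has_derivative_mult[OF kder der])
    have z: "k n t * w t = 0" if "3 < cmod t" for t using zero[OF that] by simp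
    have c: "continuous_on UNIV (\<lambda>t. k n t * w' t v + k' n t v * w t)" if "v \<in> {1, \<i>}" for v
      using that by (auto intro!: continuous_intros kcont k'cont contw cont)
    have i: "integrable lborel (\<lambda>t. k n t * w' t v + k' n t v * w t)" if "v \<in> {1, \<i>}" for v
      by (rule integrable_continuous_bounded_support[OF c[OF that], where R=3]) (simp add: zero zero')
    have I: "(LINT t|lborel. k n t * w' t v + k' n t v * w t) = 0" if "v \<in> {1, \<i>}" for v
      by (rule integral_derivative_eq_0[OF d c[OF that] z])
    have "(LINT t|lborel. (k n t * w' t 1 + k' n t 1 * w t) / 2 + \<i> * (k n t * w' t \<i> + k' n t \<i> * w t) / 2) = 0"
      using i I by simp
    also have "(\<lambda>t. (k n t * w' t 1 + k' n t 1 * w t) / 2 + \<i> * (k n t * w' t \<i> + k' n t \<i> * w t) / 2)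
       = (\<lambda>t. k n t * D t + (complex_of_real (e n))\<^sup>2 / (q n t)\<^sup>2 * w t)"
      unfolding k'sum[symmetric] D_def by (rule ext) (simp add: field_simps)
    also have "(LINT t|lborel. k n t * D t + (complex_of_real (e n))\<^sup>2 / (q n t)\<^sup>2 * w t)
       = (LINT t|lborel. k n t * D t) + (LINT t|lborel. (complex_of_real (e n))\<^sup>2 / (q n t)\<^sup>2 * w t)"
    proof (rule Bochner_Integration.integral_add)
      show "integrable lborel (\<lambda>t. k n t * D t)"
        by (rule integrable_continuous_bounded_support[where R=3])
          (auto intro!: continuous_intros kcont contD simp: zeroD)
      show "integrable lborel (\<lambda>t. (complex_of_real (e n))\<^sup>2 / (q n t)\<^sup>2 * w t)"
        using qnz by (intro integrable_continuous_bounded_support[where R=3] continuous_intros qcont contw) (auto simp: zero)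
    qed
    finally show ?thesis by (simp add: add_eq_0_iff2)
  qed
  have [measurable]: "k n \<in> borel_measurable borel" for n
    using kcont by (intro borel_measurable_continuous_onI)
  \<comment> \<open>The majorant comes from \<open>cmod (k n t) \<le> 1 / cmod t\<close>. Since
    \<open>w\<close>, and with it \<open>D\<close>, vanishes beyond radius 3, truncating the kernel
    does not change the limit.\<close>
  have lim1: "(\<lambda>n. LINT t|lborel. k n t * D t) \<longlonglongrightarrow> (LINT t|lborel. of_real kernel_mass * (cauchy_kernel t * D t))"
  proof (rule integral_dominated_convergence[where w="\<lambda>t. M * (indicator (cball 0 3) t * inverse (cmod t))"])
    show "integrable lborel (\<lambda>t. M * (indicator (cball 0 3) t * inverse (cmod t)))"
      by (intro integrable_mult_right integrable_inverse_cmod)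
    show "AE t in lborel. (\<lambda>n. k n t * D t) \<longlonglongrightarrow> of_real kernel_mass * (cauchy_kernel t * D t)"
    proof (rule AE_I2)
      fix t
      show "(\<lambda>n. k n t * D t) \<longlonglongrightarrow> of_real kernel_mass * (cauchy_kernel t * D t)"
      proof (cases "t = 0 \<or> 3 < cmod t")
        case True
        then show ?thesis using zeroD[of t] by (auto simp: k_def cauchy_kernel_def)
      next
        case False
        have "(\<lambda>n. k n t * D t) \<longlonglongrightarrow> cnj t / (t * cnj t + (complex_of_real 0)\<^sup>2) * D t"
          unfolding k_def q_def using False by (intro tendsto_intros e0) auto
        then show ?thesis using False kernel_mass_pos
          by (simp add: cauchy_kernel_def indicator_def field_simps)
      qed
    qed
    show "AE t in lborel. norm (k n t * D t) \<le> M * (indicator (cball 0 3) t * inverse (cmod t))" for n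
    proof (rule AE_I2)
      fix t
      show "norm (k n t * D t) \<le> M * (indicator (cball 0 3) t * inverse (cmod t))"
      proof (cases "t = 0 \<or> 3 < cmod t")
        case True
        then show ?thesis using zeroD[of t] by (auto simp: k_def)
      next
        case False
        have "cmod (k n t) = cmod t / ((cmod t)\<^sup>2 + (e n)\<^sup>2)"
          using qpos[of t n] unfolding k_def q norm_divide norm_of_real by simp
        also have "\<dots> \<le> cmod t / (cmod t)\<^sup>2"
          using False by (intro divide_left_mono) (auto simp: qpos intro!: mult_pos_pos add_pos_nonneg)
        also have "\<dots> = inverse (cmod t)" using False by (simp add: power2_eq_square field_simps)
        finally show ?thesis using False M(2)[of t] M(1)
          by (auto simp: norm_mult mult.commute intro!: mult_mono)
      qed
    qed
  qed auto
  \<comment> \<open>All powers of \<open>e n\<close> cancel under dilation: the Jacobian and the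
    numerator contribute a square each, the denominator a fourth power.\<close>
  have scale: "(LINT t|lborel. (complex_of_real (e n))\<^sup>2 / (q n t)\<^sup>2 * w t)
      = (LINT t|lborel. of_real (inverse ((1 + (cmod t)\<^sup>2)\<^sup>2)) * w (e n *\<^sub>R t))" for n
  proof -
    have [measurable]: "q n \<in> borel_measurable borel"
      using qcont by (intro borel_measurable_continuous_onI)
    have "(LINT t|lborel. (complex_of_real (e n))\<^sup>2 / (q n t)\<^sup>2 * w t)
       = (LINT t|lborel. \<bar>e n\<bar> ^ DIM(complex) *\<^sub>R ((complex_of_real (e n))\<^sup>2 / (q n (e n *\<^sub>R t))\<^sup>2 * w (e n *\<^sub>R t)))"
      using e[of n] by (intro lborel_integral_scale) auto
    moreover have "\<bar>e n\<bar> ^ DIM(complex) *\<^sub>R ((complex_of_real (e n))\<^sup>2 / (q n (e n *\<^sub>R t))\<^sup>2 * w (e n *\<^sub>R t))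
       = of_real (inverse ((1 + (cmod t)\<^sup>2)\<^sup>2)) * w (e n *\<^sub>R t)" for t
    proof -
      have "q n (e n *\<^sub>R t) = complex_of_real ((e n)\<^sup>2 * (1 + (cmod t)\<^sup>2))"
        unfolding q by (simp add: power_mult_distrib algebra_simps)
      moreover have "(e n)\<^sup>2 * ((e n)\<^sup>2 / ((e n)\<^sup>2 * (1 + (cmod t)\<^sup>2))\<^sup>2) = inverse ((1 + (cmod t)\<^sup>2)\<^sup>2)"
      proof -
        have "a * (a / (a * b)\<^sup>2) = inverse (b\<^sup>2)" if "a \<noteq> 0" for a b :: real
          using that by (cases "b = 0") (auto simp: power2_eq_square field_simps)
        then show ?thesis by this (use e[of n] in simp)
      qed
      ultimately have eq: "complex_of_real ((e n)\<^sup>2) * ((complex_of_real (e n))\<^sup>2 / (q n (e n *\<^sub>R t))\<^sup>2)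
         = of_real (inverse ((1 + (cmod t)\<^sup>2)\<^sup>2))"
        by (metis (no_types, lifting) of_real_divide of_real_mult of_real_power)
      show ?thesis unfolding eq[symmetric] by (simp add: scaleR_conv_of_real mult.assoc)
    qed
    ultimately show ?thesis by (simp only:)
  qed
  have lim2: "(\<lambda>n. LINT t|lborel. of_real (inverse ((1 + (cmod t)\<^sup>2)\<^sup>2)) * w (e n *\<^sub>R t))
      \<longlonglongrightarrow> (LINT t|lborel. of_real (inverse ((1 + (cmod t)\<^sup>2)\<^sup>2)) * w 0)"
  proof (rule integral_dominated_convergence[where w="\<lambda>t. W * inverse ((1 + (cmod t)\<^sup>2)\<^sup>2)"])
    show "integrable lborel (\<lambda>t. W * inverse ((1 + (cmod t)\<^sup>2)\<^sup>2))"
      by (intro integrable_mult_right integrable_inverse_quartic)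
    show "AE t in lborel. (\<lambda>n. of_real (inverse ((1 + (cmod t)\<^sup>2)\<^sup>2)) * w (e n *\<^sub>R t))
        \<longlonglongrightarrow> of_real (inverse ((1 + (cmod t)\<^sup>2)\<^sup>2)) * w 0"
    proof (rule AE_I2)
      fix t :: complex
      have "isCont w 0" by (rule has_derivative_continuous[OF der])
      moreover have "(\<lambda>n. e n *\<^sub>R t) \<longlonglongrightarrow> 0 *\<^sub>R t" by (intro tendsto_intros e0)
      ultimately have "(\<lambda>n. w (e n *\<^sub>R t)) \<longlonglongrightarrow> w 0" by (auto intro: isCont_tendsto_compose)
      then show "(\<lambda>n. of_real (inverse ((1 + (cmod t)\<^sup>2)\<^sup>2)) * w (e n *\<^sub>R t))
        \<longlonglongrightarrow> of_real (inverse ((1 + (cmod t)\<^sup>2)\<^sup>2)) * w 0" by (intro tendsto_intros)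
    qed
    show "AE t in lborel. norm (of_real (inverse ((1 + (cmod t)\<^sup>2)\<^sup>2)) * w (e n *\<^sub>R t)) \<le> W * inverse ((1 + (cmod t)\<^sup>2)\<^sup>2)" for n
      using W by (intro AE_I2) (simp only: norm_mult norm_of_real abs_inverse abs_power2 mult.commute[of W], intro mult_left_mono, auto)
  qed auto
  have "(\<lambda>n. LINT t|lborel. k n t * D t) \<longlonglongrightarrow> - (LINT t|lborel. of_real (inverse ((1 + (cmod t)\<^sup>2)\<^sup>2)) * w 0)"
    unfolding parts scale by (intro tendsto_minus lim2)
  from LIMSEQ_unique[OF lim1 this]
  have "of_real kernel_mass * (LINT t|lborel. cauchy_kernel t * D t) = - (of_real kernel_mass * w 0)"
    by (simp only: integral_mult_right_zero integral_mult_left_zero integral_complex_of_real kernel_mass_def)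
  then have "of_real kernel_mass * (LINT t|lborel. cauchy_kernel t * D t) = of_real kernel_mass * (- w 0)"
    by simp
  then show ?thesis
    using kernel_mass_pos unfolding D_def[symmetric] by (subst (asm) mult_cancel_left) auto
qed

section \<open>The Cauchy transform in one coordinate\<close>

lemma norm_axis_complex: "norm (axis j (t::complex)) = cmod t"
  by (simp add: norm_eq_sqrt_inner inner_axis_axis)

lemma bounded_linear_axis: "bounded_linear (axis j :: complex \<Rightarrow> complex^'n)"
  by (intro linear_conv_bounded_linear[THEN iffD1] linearI) (auto simp: axis_def vec_eq_iff)

lemma axis_measurable [measurable]: "(axis j :: complex \<Rightarrow> complex^'n) \<in> borel_measurable borel"
  by (intro borel_measurable_continuous_onI linear_continuous_on bounded_linear_axis)

text \<open>The transpose of \<open>cauchy_op\<close> for the bilinear pairing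
  \<open>\<integral> g u\<close>, without conjugation: only the direction of the shift changes. On
  suitable test functions it is a left inverse of \<open>- dzbar j\<close>.\<close>

definition cauchy_adj :: "'n::finite \<Rightarrow> (complex^'n \<Rightarrow> complex) \<Rightarrow> complex^'n \<Rightarrow> complex" where
  "cauchy_adj j u z = (LINT t|lborel. cauchy_kernel t * u (z + axis j t))"

definition cauchy_op :: "'n::finite \<Rightarrow> (complex^'n \<Rightarrow> complex) \<Rightarrow> complex^'n \<Rightarrow> complex" where
  "cauchy_op j g z = (LINT t|lborel. cauchy_kernel t * g (z - axis j t))"

section \<open>Uniform estimates for test functions and the adjoint transform\<close>

lemma test_function_bounded_support:
  assumes "u \<in> test_functions \<Omega>"
  obtains R where "0 \<le> R" "\<And>x. R < norm x \<Longrightarrow> u x = 0"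
proof -
  have "bounded (fun_support u)"
    using assms by (auto simp: test_functions_def compact_imp_bounded)
  then obtain R where R: "\<And>x. x \<in> fun_support u \<Longrightarrow> norm x \<le> R"
    unfolding bounded_iff by blast
  have "u x = 0" if "max 0 R < norm x" for x
    using R[of x] that not_in_fun_support[of x u] by fastforce
  then show ?thesis using that[of "max 0 R"] by auto
qed

lemma test_function_bounded:
  assumes "u \<in> test_functions \<Omega>"
  obtains M where "0 \<le> M" "\<And>x. cmod (u x) \<le> M"
proof -
  obtain R where "\<And>x. R < norm x \<Longrightarrow> u x = 0" using test_function_bounded_support[OF assms] by blast
  from bounded_continuous_bounded_support[OF smooth_fun_continuous_on[OF test_functions_smooth[OF assms]] this] that
  show ?thesis by blast
qed

lemma test_function_uniformly_continuous:
  assumes u: "u \<in> test_functions \<Omega>" and "0 < e"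
  obtains d where "0 < d" "\<And>x y. dist x y < d \<Longrightarrow> dist (u x) (u y) < e"
proof -
  obtain R where R: "\<And>x. R < norm x \<Longrightarrow> u x = 0" using test_function_bounded_support[OF u] by blast
  have "uniformly_continuous_on (cball 0 (R + 1)) u"
    by (intro compact_uniformly_continuous smooth_fun_continuous_on test_functions_smooth[OF u] compact_cball)
  then obtain d where d: "0 < d" "\<And>x y. x \<in> cball 0 (R + 1) \<Longrightarrow> y \<in> cball 0 (R + 1) \<Longrightarrow> dist x y < d \<Longrightarrow> dist (u x) (u y) < e"
    unfolding uniformly_continuous_on_def using \<open>0 < e\<close> by (metis dist_commute)
  \<comment> \<open>Points less than 1 apart either both lie in the ball of radius
    \<open>R + 1\<close> or both lie beyond radius \<open>R\<close>, where \<open>u\<close>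
    vanishes.\<close>
  have "dist (u x) (u y) < e" if *: "dist x y < min d 1" for x y
  proof (cases "norm x \<le> R + 1 \<and> norm y \<le> R + 1")
    case True
    then show ?thesis using d(2)[of x y] * by simp
  next
    case False
    have "\<bar>norm x - norm y\<bar> < 1" using * norm_triangle_ineq3[of x y] by (simp add: dist_norm)
    then have "R < norm x" "R < norm y" using False by auto
    then show ?thesis using R \<open>0 < e\<close> by simp
  qed
  then show ?thesis using that[of "min d 1"] d(1) by auto
qed

text \<open>Uniformity in \<open>x\<close> is what differentiation under the integral requires. It
  follows from the mean value inequality and the uniform continuity of the finitely many basis
  derivatives, each of which is allowed the share \<open>e / DIM('a)\<close>.\<close>

lemma test_function_uniform_linearization:
  fixes u :: "'a::euclidean_space \<Rightarrow> complex"
  assumes u: "u \<in> test_functions \<Omega>" and "0 < e"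
  obtains d where "0 < d"
    "\<And>x h. norm h < d \<Longrightarrow> cmod (u (x + h) - u x - dir_deriv h u x) \<le> e * norm h"
proof -
  note s = test_functions_smooth[OF u]
  let ?N = "real DIM('a)"
  have e': "0 < e / ?N" using \<open>0 < e\<close> by simp
  have "\<exists>d>0. \<forall>x y. dist x y < d \<longrightarrow> dist (dir_deriv b u x) (dir_deriv b u y) < e / ?N" if "b \<in> Basis" for b
    using test_function_uniformly_continuous[OF dir_deriv_test_function[OF u] e'] by metis
  then obtain \<delta> where \<delta>: "\<And>b. b \<in> Basis \<Longrightarrow> 0 < \<delta> b"
    "\<And>b x y. b \<in> Basis \<Longrightarrow> dist x y < \<delta> b \<Longrightarrow> dist (dir_deriv b u x) (dir_deriv b u y) < e / ?N"
    by metis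
  define d where "d = Min (\<delta> ` Basis)"
  have d: "0 < d" "\<And>b. b \<in> Basis \<Longrightarrow> d \<le> \<delta> b"
    using \<delta>(1) by (auto simp: d_def)
  have diff: "cmod (dir_deriv v u y - dir_deriv v u x) \<le> e * norm v" if "dist y x < d" for x y v
  proof -
    have "cmod (dir_deriv v u y - dir_deriv v u x) = cmod (\<Sum>b\<in>Basis. (v \<bullet> b) *\<^sub>R (dir_deriv b u y - dir_deriv b u x))"
      by (simp only: dir_deriv_Basis[OF s, of v] sum_subtractf[symmetric] scaleR_diff_right)
    also have "\<dots> \<le> (\<Sum>b\<in>(Basis::'a set). norm v * (e / ?N))"
    proof (rule sum_norm_le)
      fix b :: 'a assume b: "b \<in> Basis"
      have "cmod (dir_deriv b u y - dir_deriv b u x) \<le> e / ?N"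
        using \<delta>(2)[OF b, of y x] d(2)[OF b] that by (simp add: dist_norm)
      then show "cmod ((v \<bullet> b) *\<^sub>R (dir_deriv b u y - dir_deriv b u x)) \<le> norm v * (e / ?N)"
        using Basis_le_norm[OF b, of v] unfolding norm_scaleR real_norm_def
        by (intro mult_mono) auto
    qed
    also have "\<dots> = e * norm v" by simp
    finally show ?thesis .
  qed
  have "cmod (u (x + h) - u x - dir_deriv h u x) \<le> e * norm h" if h: "norm h < d" for x h
  proof -
    have "norm (u (x + h) - u x - dir_deriv ((x + h) - x) u x) \<le> norm ((x + h) - x) * e"
    proof (rule differentiable_bound_linearization[where S="ball x d" and f'="\<lambda>y v. dir_deriv v u y"])
      show "x + t *\<^sub>R (x + h - x) \<in> ball x d" if "t \<in> {0..1}" for t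
      proof -
        have "norm (t *\<^sub>R h) \<le> norm h" using that by (simp add: mult_left_le_one_le)
        then show ?thesis using h by (simp add: dist_norm)
      qed
      show "(u has_derivative (\<lambda>v. dir_deriv v u y)) (at y within ball x d)" for y
        using smooth_fun_has_derivative[OF s] has_derivative_at_withinI by blast
      show "onorm ((\<lambda>v. dir_deriv v u y) - (\<lambda>v. dir_deriv v u x)) \<le> e" if "y \<in> ball x d" for y
        using diff[of y x] that \<open>0 < e\<close> by (intro onorm_bound) (auto simp: dist_commute fun_diff_def)
      show "x \<in> ball x d" using d by simp
    qed
    then show ?thesis by (simp add: mult.commute)
  qed
  then show ?thesis using that[OF d(1)] by blast
qed

lemma integrable_kernel_mult:
  fixes v :: "complex \<Rightarrow> complex"
  assumes [measurable]: "v \<in> borel_measurable borel" and M: "\<And>t. cmod (v t) \<le> M"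
  shows "integrable lborel (\<lambda>t. cauchy_kernel t * v t)"
proof (rule Bochner_Integration.integrable_bound)
  show "integrable lborel (\<lambda>t. cmod (cauchy_kernel t) * M)"
    using integrable_cauchy_kernel by (intro integrable_mult_left integrable_norm)
  show "AE t in lborel. norm (cauchy_kernel t * v t) \<le> norm (cmod (cauchy_kernel t) * M)"
  proof (rule AE_I2)
    fix t
    have "cmod (v t) \<le> \<bar>M\<bar>" using M[of t] by linarith
    then show "norm (cauchy_kernel t * v t) \<le> norm (cmod (cauchy_kernel t) * M)"
      by (auto simp: norm_mult abs_mult intro!: mult_left_mono)
  qed
qed simp

lemma integrable_kernel_test_function:
  assumes u: "u \<in> test_functions \<Omega>"
  shows "integrable lborel (\<lambda>t. cauchy_kernel t * u (z + axis j t))"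
proof -
  obtain M where "\<And>x. cmod (u x) \<le> M" using test_function_bounded[OF u] by blast
  moreover have [measurable]: "u \<in> borel_measurable borel"
    using u by (intro smooth_fun_borel_measurable test_functions_smooth)
  ultimately show ?thesis by (intro integrable_kernel_mult) auto
qed

text \<open>The first-order error of \<open>u\<close> is uniform in the base point, so integrating
  it against the integrable kernel keeps it small compared with \<open>norm (y - z)\<close>.\<close>

lemma cauchy_adj_has_derivative:
  assumes u: "u \<in> test_functions \<Omega>"
  shows "(cauchy_adj j u has_derivative (\<lambda>v. cauchy_adj j (dir_deriv v u) z)) (at z)"
  unfolding has_derivative_at_alt
proof (intro conjI allI impI)
  note s = test_functions_smooth[OF u]
  note int = integrable_kernel_test_function[OF u] integrable_kernel_test_function[OF dir_deriv_test_function[OF u]]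
  show "bounded_linear (\<lambda>v. cauchy_adj j (dir_deriv v u) z)"
  proof (intro linear_conv_bounded_linear[THEN iffD1] linearI)
    fix a b :: "complex^'a" and c :: real
    note l = dir_deriv_linear[OF s]
    show "cauchy_adj j (dir_deriv (a + b) u) z = cauchy_adj j (dir_deriv a u) z + cauchy_adj j (dir_deriv b u) z"
      using Bochner_Integration.integral_add[OF int(2) int(2)]
      by (simp add: cauchy_adj_def linear_add[OF l] distrib_left)
    have "cauchy_adj j (dir_deriv (c *\<^sub>R a) u) z = (LINT t|lborel. c *\<^sub>R (cauchy_kernel t * dir_deriv a u (z + axis j t)))"
      by (simp add: cauchy_adj_def linear_cmul[OF l])
    also have "\<dots> = c *\<^sub>R cauchy_adj j (dir_deriv a u) z"
      unfolding cauchy_adj_def by (rule integral_scaleR_right)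
    finally show "cauchy_adj j (dir_deriv (c *\<^sub>R a) u) z = c *\<^sub>R cauchy_adj j (dir_deriv a u) z" .
  qed
  fix e :: real assume "0 < e"
  define k where "k = (LINT t|lborel. cmod (cauchy_kernel t))"
  have k: "0 \<le> k" unfolding k_def by (intro integral_nonneg_AE) auto
  \<comment> \<open>The added 1 keeps the divisor positive.\<close>
  define e' where "e' = e / (k + 1)"
  have e': "0 < e'" using \<open>0 < e\<close> k by (simp add: e'_def)
  obtain d where d: "0 < d" "\<And>x h. norm h < d \<Longrightarrow> cmod (u (x + h) - u x - dir_deriv h u x) \<le> e' * norm h"
    using test_function_uniform_linearization[OF u e'] by blast
  show "\<exists>d>0. \<forall>y. norm (y - z) < d \<longrightarrow>
      norm (cauchy_adj j u y - cauchy_adj j u z - cauchy_adj j (dir_deriv (y - z) u) z) \<le> e * norm (y - z)"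
  proof (intro exI[of _ d] conjI allI impI d(1))
    fix y assume y: "norm (y - z) < d"
    let ?h = "y - z"
    let ?g = "\<lambda>t. u (y + axis j t) - u (z + axis j t) - dir_deriv ?h u (z + axis j t)"
    have "cauchy_adj j u y - cauchy_adj j u z - cauchy_adj j (dir_deriv ?h u) z
        = (LINT t|lborel. cauchy_kernel t * u (y + axis j t) - cauchy_kernel t * u (z + axis j t)
            - cauchy_kernel t * dir_deriv ?h u (z + axis j t))"
      unfolding cauchy_adj_def
      by (simp only: Bochner_Integration.integral_diff Bochner_Integration.integrable_diff int)
    also have "\<dots> = (LINT t|lborel. cauchy_kernel t * ?g t)" by (simp add: algebra_simps)
    finally have eq: "cauchy_adj j u y - cauchy_adj j u z - cauchy_adj j (dir_deriv ?h u) z = (LINT t|lborel. cauchy_kernel t * ?g t)" .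
    have "cmod (LINT t|lborel. cauchy_kernel t * ?g t) \<le> (LINT t|lborel. cmod (cauchy_kernel t) * (e' * norm ?h))"
    proof (rule Bochner_Integration.integral_norm_bound_integral)
      have "integrable lborel (\<lambda>t. cauchy_kernel t * u (y + axis j t) - cauchy_kernel t * u (z + axis j t)
            - cauchy_kernel t * dir_deriv ?h u (z + axis j t))"
        by (intro Bochner_Integration.integrable_diff int)
      then show "integrable lborel (\<lambda>t. cauchy_kernel t * ?g t)" by (simp add: algebra_simps)
      show "integrable lborel (\<lambda>t. cmod (cauchy_kernel t) * (e' * norm ?h))"
        using integrable_cauchy_kernel by (intro integrable_mult_left integrable_norm)
      fix t
      have "cmod (?g t) \<le> e' * norm ?h"
        using d(2)[OF y, of "z + axis j t"] by (simp add: algebra_simps)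
      then show "norm (cauchy_kernel t * ?g t) \<le> cmod (cauchy_kernel t) * (e' * norm ?h)"
        unfolding norm_mult by (rule mult_left_mono) simp
    qed
    also have "\<dots> = k * (e' * norm ?h)"
      unfolding k_def by (rule integral_mult_left_zero)
    also have "\<dots> \<le> (k + 1) * (e' * norm ?h)"
      using e' by (intro mult_right_mono) auto
    also have "\<dots> = e * norm ?h" using k by (simp add: e'_def)
    finally show "norm (cauchy_adj j u y - cauchy_adj j u z - cauchy_adj j (dir_deriv ?h u) z) \<le> e * norm ?h"
      unfolding eq .
  qed
qed

lemma dir_deriv_cauchy_adj:
  "u \<in> test_functions \<Omega> \<Longrightarrow> dir_deriv v (cauchy_adj j u) = cauchy_adj j (dir_deriv v u)"
  by (intro ext dir_deriv_eqI cauchy_adj_has_derivative)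

text \<open>Derivatives commute with the transform, so the images of test functions form a class
  closed under differentiation. The truncated kernel enlarges the support by at most 3, possibly
  beyond \<Omega>, hence \<open>UNIV\<close>.\<close>

lemma cauchy_adj_test_function:
  assumes u: "u \<in> test_functions \<Omega>"
  shows "cauchy_adj j u \<in> test_functions UNIV"
proof -
  obtain R where R: "\<And>x. R < norm x \<Longrightarrow> u x = 0" using test_function_bounded_support[OF u] by blast
  have s: "smooth_fun (cauchy_adj j u)"
  proof (rule smooth_fun_coinduct[where X="cauchy_adj j ` test_functions \<Omega>"])
    show "g differentiable_on UNIV" if "g \<in> cauchy_adj j ` test_functions \<Omega>" for g
      using that cauchy_adj_has_derivative unfolding differentiable_on_def differentiable_def by fastforce
    show "dir_deriv b g \<in> cauchy_adj j ` test_functions \<Omega>" if "g \<in> cauchy_adj j ` test_functions \<Omega>" for g b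
      using that by (auto simp: dir_deriv_cauchy_adj dir_deriv_test_function)
  qed (use u in auto)
  show ?thesis
  proof (rule test_functionsI[OF s compact_cball[of 0 "R + 3"]])
    fix z :: "complex^'a" assume z: "z \<notin> cball 0 (R + 3)"
    have "cauchy_kernel t * u (z + axis j t) = 0" for t
    proof (cases "3 < cmod t")
      case False
      have "norm z \<le> norm (z + axis j t) + norm (axis j t)"
        using norm_triangle_ineq4[of "z + axis j t" "axis j t"] by simp
      then have "R < norm (z + axis j t)" using z False by (simp add: norm_axis_complex)
      then show ?thesis using R by simp
    qed (simp add: cauchy_kernel_outside)
    then show "cauchy_adj j u z = 0"
      by (simp only: cauchy_adj_def Bochner_Integration.integral_zero)
  qed simp
qed

lemma dzbar_cauchy_adj:
  assumes u: "u \<in> test_functions \<Omega>"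
  shows "dzbar i (cauchy_adj j u) z = cauchy_adj j (dzbar i u) z"
proof -
  note int = integrable_kernel_test_function[OF dir_deriv_test_function[OF u]]
  have "cauchy_adj j (dzbar i u) z =
      (LINT t|lborel. (1/2) * (cauchy_kernel t * dir_deriv (axis i 1) u (z + axis j t)
        + \<i> * (cauchy_kernel t * dir_deriv (axis i \<i>) u (z + axis j t))))"
    unfolding cauchy_adj_def dzbar_def
    by (intro Bochner_Integration.integral_cong) (auto simp: field_simps)
  also have "\<dots> = (1/2) * (cauchy_adj j (dir_deriv (axis i 1) u) z + \<i> * cauchy_adj j (dir_deriv (axis i \<i>) u) z)"
    unfolding cauchy_adj_def
    by (simp only: integral_mult_right_zero Bochner_Integration.integral_add integrable_mult_right int)
  finally show ?thesis by (simp add: dzbar_def dir_deriv_cauchy_adj[OF u])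
qed

text \<open>The Cauchy--Pompeiu formula on the complex line through \<open>z\<close> in direction
  \<open>j\<close>; the vanishing hypothesis confines \<open>u\<close> on that line to the disc
  where the kernel is not truncated.\<close>

lemma cauchy_adj_dzbar:
  assumes u: "u \<in> test_functions \<Omega>" and zero: "\<And>t. 3 < cmod t \<Longrightarrow> u (z + axis j t) = 0"
  shows "cauchy_adj j (dzbar j u) z = - u z"
proof -
  note s = test_functions_smooth[OF u]
  have d: "((\<lambda>t. u (z + axis j t)) has_derivative (\<lambda>v. dir_deriv (axis j v) u (z + axis j t))) (at t)" for t
  proof -
    have "((\<lambda>t. z + axis j t) has_derivative (\<lambda>v. axis j v)) (at t)"
      using has_derivative_add[OF has_derivative_const bounded_linear_imp_has_derivative[OF bounded_linear_axis]]
      by simp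
    from has_derivative_compose[OF this smooth_fun_has_derivative[OF s]] show ?thesis .
  qed
  have c: "continuous_on UNIV (\<lambda>t. dir_deriv v u (z + axis j t))" for v
    by (intro continuous_on_compose2[OF smooth_fun_continuous_on[OF test_functions_smooth[OF dir_deriv_test_function[OF u]], of UNIV]]
         continuous_on_add continuous_on_const linear_continuous_on bounded_linear_axis) auto
  have eq: "z + axis j 0 = z" by (simp add: axis_def vec_eq_iff)
  show ?thesis
    using cauchy_pompeiu[OF d c c zero] unfolding eq cauchy_adj_def dzbar_def .
qed

section \<open>Convexity, Fubini and \<open>L\<^sup>r\<close> bounds for the transform\<close>

lemma powr_above_tangent:
  fixes p m x :: real
  assumes "1 \<le> p" "0 < m" "0 \<le> x"
  shows "m powr p + p * m powr (p - 1) * (x - m) \<le> x powr p"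
proof (cases "x = 0")
  \<comment> \<open>The tangent inequality for convex functions is applied on the open half-line, so
    the endpoint is computed directly.\<close>
  case True
  have "m powr (p - 1) * m = m powr p" using assms by (simp add: powr_diff)
  then have "m powr p + p * m powr (p - 1) * (x - m) = (1 - p) * m powr p"
    using True by (simp add: algebra_simps)
  also have "\<dots> \<le> 0" using assms by (intro mult_nonpos_nonneg) auto
  finally show ?thesis using True by simp
next
  case False
  have "((\<lambda>x. x powr p) has_field_derivative p * m powr (p - 1)) (at m within {0<..})"
    using assms by (auto intro!: derivative_eq_intros)
  then have "(p * m powr (p - 1)) * (x - m) \<le> x powr p - m powr p"
    using assms False
    by (intro convex_on_imp_above_tangent[where A="{0<..}"] powr_convex) (auto simp: interior_open)
  then show ?thesis by simp
qed

text \<open>The summand 1 in \<open>c\<close> avoids the case distinction on \<open>\<integral>k = 0\<close>.\<close>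

lemma weighted_powr_jensen:
  fixes k x :: "'a \<Rightarrow> real"
  assumes p: "1 \<le> p" and k: "integrable M k" "\<And>t. 0 \<le> k t"
    and x[measurable]: "x \<in> borel_measurable M" and x0: "\<And>t. 0 \<le> x t"
    and kx: "integrable M (\<lambda>t. k t * x t powr p)"
  defines "c \<equiv> (LINT t|M. k t) + 1"
  shows "integrable M (\<lambda>t. k t * x t)"
    and "(LINT t|M. k t * x t) powr p \<le> c powr (p - 1) * (LINT t|M. k t * x t powr p)"
proof -
  have [measurable]: "k \<in> borel_measurable M" using k by auto
  have le: "y \<le> 1 + y powr p" if "0 \<le> y" for y :: real
  proof (cases "y \<le> 1")
    case False
    then have "y powr 1 \<le> y powr p" using p by (intro powr_mono) auto
    then show ?thesis using False by simp
  qed (simp add: add_increasing2)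
  show int: "integrable M (\<lambda>t. k t * x t)"
  proof (rule Bochner_Integration.integrable_bound[OF Bochner_Integration.integrable_add[OF k(1) kx]])
    show "AE t in M. norm (k t * x t) \<le> norm (k t + k t * x t powr p)"
    proof (rule AE_I2)
      fix t
      have "k t * x t \<le> k t * (1 + x t powr p)" using k le[OF x0] by (intro mult_left_mono) auto
      then show "norm (k t * x t) \<le> norm (k t + k t * x t powr p)"
        using k(2)[of t] x0[of t] by (simp add: algebra_simps)
    qed
  qed simp
  define I where "I = (LINT t|M. k t * x t)"
  have I0: "0 \<le> I" unfolding I_def using k x0 by (intro integral_nonneg_AE) auto
  have J0: "0 \<le> (LINT t|M. k t * x t powr p)" using k by (intro integral_nonneg_AE) auto
  have \<kappa>0: "0 \<le> (LINT t|M. k t)" using k by (intro integral_nonneg_AE) auto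
  then have c: "0 < c" by (simp add: c_def)
  show "I powr p \<le> c powr (p - 1) * (LINT t|M. k t * x t powr p)"
  proof (cases "I = 0")
    case True
    then show ?thesis using J0 by simp
  next
    case False
    \<comment> \<open>The tangent is taken at the weighted mean \<open>m\<close> and integrated
      against \<open>k\<close>.\<close>
    define m where "m = I / c"
    have m: "0 < m" "I = c * m" using False I0 c by (auto simp: m_def)
    have mp: "m powr (p - 1) * m = m powr p" using m by (simp add: powr_diff)
    \<comment> \<open>Since the integral of \<open>k\<close> is \<open>c - 1\<close>, it is
      \<open>p \<ge> 1\<close> that pays for the summand 1 in \<open>c\<close>.\<close>
    have "c * m powr p \<le> m powr p * (c - 1 + p)"
      using p by (subst mult.commute, intro mult_left_mono) auto
    also have "\<dots> = m powr p * (LINT t|M. k t) + p * m powr (p - 1) * (I - m * (LINT t|M. k t))"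
    proof -
      have "I - m * (LINT t|M. k t) = m" by (simp add: m(2) c_def algebra_simps)
      then show ?thesis using mp by (simp add: c_def algebra_simps)
    qed
    also have "\<dots> = (LINT t|M. m powr p * k t + p * m powr (p - 1) * (k t * x t - m * k t))"
      unfolding I_def using k int by simp
    also have "\<dots> \<le> (LINT t|M. k t * x t powr p)"
    proof (rule integral_mono[OF _ kx])
      show "integrable M (\<lambda>t. m powr p * k t + p * m powr (p - 1) * (k t * x t - m * k t))"
        using k int by simp
      fix t
      have "k t * (m powr p + p * m powr (p - 1) * (x t - m)) \<le> k t * x t powr p"
        by (intro mult_left_mono powr_above_tangent p m k x0)
      then show "m powr p * k t + p * m powr (p - 1) * (k t * x t - m * k t) \<le> k t * x t powr p"
        by (simp add: algebra_simps)
    qed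
    finally have *: "c * m powr p \<le> (LINT t|M. k t * x t powr p)" .
    have "I powr p = c powr (p - 1) * (c * m powr p)"
      using m c by (simp add: m(2) powr_mult powr_diff)
    also have "\<dots> \<le> c powr (p - 1) * (LINT t|M. k t * x t powr p)"
      using * by (intro mult_left_mono) auto
    finally show ?thesis .
  qed
qed

text \<open>By translation invariance the inner integral of the norm is \<open>norm (k t)\<close>
  times the \<open>L\<^sup>1\<close> norm of \<open>g\<close>. The general value type lets it serve
  the complex kernel as well as the real functions \<open>cmod (cauchy_kernel t)\<close> and
  \<open>cmod (g z) powr p\<close>.\<close>

lemma integrable_conv_pair:
  fixes k :: "complex \<Rightarrow> 'b::{real_normed_field, banach, second_countable_topology}"
    and g :: "complex^'n \<Rightarrow> 'b"
  assumes k: "integrable lborel k" and g: "integrable lborel g"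
  shows "integrable (lborel \<Otimes>\<^sub>M lborel) (\<lambda>(t, z). k t * g (z - axis j t))"
proof (rule lborel_pair.Fubini_integrable)
  have [measurable]: "k \<in> borel_measurable borel" "g \<in> borel_measurable borel"
    using k g borel_measurable_integrable by auto
  show "(\<lambda>(t, z). k t * g (z - axis j t)) \<in> borel_measurable (lborel \<Otimes>\<^sub>M lborel)"
    by measurable
  have tr: "integrable lborel (\<lambda>z. g (z - axis j t))" for t
    using lborel_integrable_translate[OF g, of "- axis j t"] by simp
  show "AE t in lborel. integrable lborel (\<lambda>z. case (t, z) of (t, z) \<Rightarrow> k t * g (z - axis j t))"
    using tr by (intro AE_I2) (simp add: integrable_mult_right)
  have "(LINT z|lborel. norm (k t * g (z - axis j t))) = norm (k t) * (LINT z|lborel. norm (g z))" for t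
    using lborel_integral_translate[of "\<lambda>z. norm (g z)" "- axis j t"] by (simp add: norm_mult)
  then show "integrable lborel (\<lambda>t. LINT z|lborel. norm (case (t, z) of (t, z) \<Rightarrow> k t * g (z - axis j t)))"
    using k by (simp add: integrable_mult_left)
qed

text \<open>Fubini twice, with the translation by \<open>axis j t\<close> in between; boundedness of
  \<open>u\<close> makes both double integrals converge absolutely.\<close>

lemma cauchy_op_duality:
  assumes g: "integrable lborel g"
    and u[measurable]: "u \<in> borel_measurable borel" and M: "\<And>z. cmod (u z) \<le> M"
  shows "(LINT z|lborel. cauchy_op j g z * u z) = (LINT z|lborel. g z * cauchy_adj j u z)"
    and "integrable lborel (\<lambda>z. cauchy_op j g z * u z)"
proof -
  have [measurable]: "g \<in> borel_measurable borel" using g borel_measurable_integrable by auto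
  let ?f = "\<lambda>t z. cauchy_kernel t * g (z - axis j t) * u z"
  have 1: "integrable (lborel \<Otimes>\<^sub>M lborel) (case_prod ?f)"
  proof (rule Bochner_Integration.integrable_bound)
    show "integrable (lborel \<Otimes>\<^sub>M lborel) (\<lambda>x. M * norm (case x of (t, z) \<Rightarrow> cauchy_kernel t * g (z - axis j t)))"
      by (intro integrable_mult_right integrable_norm integrable_conv_pair integrable_cauchy_kernel g)
    show "AE x in lborel \<Otimes>\<^sub>M lborel. norm (case_prod ?f x)
        \<le> norm (M * norm (case x of (t, z) \<Rightarrow> cauchy_kernel t * g (z - axis j t)))"
    proof (rule AE_I2, clarify)
      fix t z
      have "cmod (u z) \<le> \<bar>M\<bar>" using M[of z] by linarith
      then show "norm (?f t z) \<le> norm (M * norm (cauchy_kernel t * g (z - axis j t)))"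
        by (simp add: norm_mult abs_mult mult.commute mult_right_mono)
    qed
  qed measurable
  have eq: "(LINT t|lborel. ?f t z) = cauchy_op j g z * u z" for z
    unfolding cauchy_op_def by (rule integral_mult_left_zero)
  show "integrable lborel (\<lambda>z. cauchy_op j g z * u z)"
    using lborel_pair.integrable_snd[OF 1] unfolding eq .
  let ?h = "\<lambda>z t. cauchy_kernel t * u (z + axis j t) * g z"
  have "integrable (lborel \<Otimes>\<^sub>M lborel) (\<lambda>(t, z). ?h z t)"
  proof (rule Bochner_Integration.integrable_bound)
    show "integrable (lborel \<Otimes>\<^sub>M lborel) (\<lambda>x. M * norm (case x of (t, z) \<Rightarrow> cauchy_kernel t * g z))"
    proof (intro integrable_mult_right integrable_norm lborel_pair.Fubini_integrable)
      show "integrable lborel (\<lambda>t. LINT z|lborel. norm (case (t, z) of (t, z) \<Rightarrow> cauchy_kernel t * g z))"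
        using integrable_cauchy_kernel by (simp add: norm_mult integrable_mult_left)
      show "AE t in lborel. integrable lborel (\<lambda>z. case (t, z) of (t, z) \<Rightarrow> cauchy_kernel t * g z)"
        using g by (intro AE_I2) (simp add: integrable_mult_right)
    qed measurable
    show "AE x in lborel \<Otimes>\<^sub>M lborel. norm (case x of (t, z) \<Rightarrow> ?h z t)
        \<le> norm (M * norm (case x of (t, z) \<Rightarrow> cauchy_kernel t * g z))"
    proof (rule AE_I2, clarify)
      fix t and z :: "complex^'a"
      have "cmod (u (z + axis j t)) \<le> \<bar>M\<bar>" using M[of "z + axis j t"] by linarith
      then have "cmod (u (z + axis j t)) * cmod (cauchy_kernel t * g z) \<le> \<bar>M\<bar> * cmod (cauchy_kernel t * g z)"
        by (intro mult_right_mono) auto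
      then show "norm (?h z t) \<le> norm (M * norm (cauchy_kernel t * g z))"
        by (simp add: norm_mult abs_mult ac_simps)
    qed
  qed measurable
  then have 2: "integrable (lborel \<Otimes>\<^sub>M lborel) (case_prod (\<lambda>t z. ?h z t))" by simp
  have "(LINT z|lborel. cauchy_op j g z * u z) = (LINT z|lborel. LINT t|lborel. ?f t z)"
    by (simp only: eq)
  also have "\<dots> = (LINT t|lborel. LINT z|lborel. ?f t z)"
    by (rule lborel_pair.Fubini_integral[OF 1])
  also have "\<dots> = (LINT t|lborel. LINT z|lborel. ?h z t)"
  proof (rule Bochner_Integration.integral_cong[OF refl])
    fix t
    have "(LINT z|lborel. ?f t z) = (LINT z|lborel. ?f t (z + axis j t))"
      by (rule lborel_integral_translate[symmetric]) measurable
    then show "(LINT z|lborel. ?f t z) = (LINT z|lborel. ?h z t)"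
      by (simp add: ac_simps)
  qed
  also have "\<dots> = (LINT z|lborel. LINT t|lborel. ?h z t)"
    by (rule lborel_pair.Fubini_integral[OF 2, symmetric])
  also have "\<dots> = (LINT z|lborel. cauchy_adj j u z * g z)"
    unfolding cauchy_adj_def by (simp only: integral_mult_left_zero)
  finally show "(LINT z|lborel. cauchy_op j g z * u z) = (LINT z|lborel. g z * cauchy_adj j u z)"
    by (simp add: mult.commute)
qed

text \<open>Functions, not classes: for \<open>r = \<infinity>\<close> the bound holds at every
  point, so that supports and estimates can be handled pointwise.\<close>

definition Lr_borel :: "ennreal \<Rightarrow> ('a::euclidean_space \<Rightarrow> complex) \<Rightarrow> bool" where
  "Lr_borel r g \<longleftrightarrow> g \<in> borel_measurable borel \<and>
     (if r = \<infinity> then \<exists>C. \<forall>z. cmod (g z) \<le> C else integrable lborel (\<lambda>z. cmod (g z) powr enn2real r))"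

lemma Lr_borel_measurable: "Lr_borel r g \<Longrightarrow> g \<in> borel_measurable borel"
  by (simp add: Lr_borel_def)

lemma enn2real_ge_1: "1 \<le> r \<Longrightarrow> r \<noteq> \<infinity> \<Longrightarrow> 1 \<le> enn2real r"
  using enn2real_mono[of 1 r] by (simp add: less_top)

text \<open>Bounded support puts \<open>L\<^sup>r\<close> inside \<open>L\<^sup>1\<close>: for
  finite \<open>r\<close>, \<open>cmod (g z)\<close> is at most the indicator of the ball plus
  \<open>cmod (g z) powr enn2real r\<close>.\<close>

lemma Lr_borel_integrable:
  assumes r: "1 \<le> r" and g: "Lr_borel r g" and R: "\<And>z. R < norm z \<Longrightarrow> g z = 0"
  shows "integrable lborel g"
proof (cases "r = \<infinity>")
  case True
  then obtain C where C: "\<And>z. cmod (g z) \<le> C" and [measurable]: "g \<in> borel_measurable borel"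
    using g by (auto simp: Lr_borel_def)
  show ?thesis
  proof (rule Bochner_Integration.integrable_bound)
    show "integrable lborel (\<lambda>z::'a. C * indicator (cball 0 R) z)"
      using emeasure_bounded_finite[OF bounded_cball[of "0::'a" R]]
      by (intro integrable_mult_right integrable_real_indicator) auto
    show "AE z in lborel. norm (g z) \<le> norm (C * indicator (cball 0 R) z)"
      using C R by (intro AE_I2) (auto simp: indicator_def not_le intro: order_trans[OF C])
  qed simp
next
  case False
  then have int: "integrable lborel (\<lambda>z. cmod (g z) powr enn2real r)" and [measurable]: "g \<in> borel_measurable borel"
    using g by (auto simp: Lr_borel_def)
  have p: "1 \<le> enn2real r" using enn2real_ge_1[OF r False] .
  show ?thesis
  proof (rule Bochner_Integration.integrable_bound)
    show "integrable lborel (\<lambda>z::'a. indicator (cball 0 R) z + cmod (g z) powr enn2real r)"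
      using emeasure_bounded_finite[OF bounded_cball[of "0::'a" R]] int
      by (intro Bochner_Integration.integrable_add integrable_real_indicator) auto
    show "AE z in lborel. norm (g z) \<le> norm (indicator (cball 0 R) z + cmod (g z) powr enn2real r)"
    proof (rule AE_I2)
      fix z :: 'a
      show "norm (g z) \<le> norm (indicator (cball 0 R) z + cmod (g z) powr enn2real r)"
      proof (cases "cmod (g z) \<le> 1")
        case True
        then show ?thesis using R[of z] by (auto simp: indicator_def not_le intro: add_increasing2)
      next
        case False
        then have "cmod (g z) powr 1 \<le> cmod (g z) powr enn2real r" using p by (intro powr_mono) auto
        then show ?thesis using False by (auto simp: indicator_def)
      qed
    qed
  qed simp
qed

lemma Lr_borel_bounded_mult:
  assumes g: "Lr_borel r g" and r: "1 \<le> r" and m[measurable]: "m \<in> borel_measurable borel"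
    and B: "\<And>z. cmod (m z) \<le> B"
  shows "Lr_borel r (\<lambda>z. m z * g z)"
proof -
  have [measurable]: "g \<in> borel_measurable borel" using g by (rule Lr_borel_measurable)
  have B0: "0 \<le> B" using order_trans[OF norm_ge_zero B] .
  have le: "cmod (m z * g z) \<le> B * cmod (g z)" for z
    unfolding norm_mult by (intro mult_right_mono B) simp
  show ?thesis
  proof (cases "r = \<infinity>")
    case True
    then obtain C where C: "\<And>z. cmod (g z) \<le> C" using g by (auto simp: Lr_borel_def)
    have "cmod (m z * g z) \<le> B * C" for z
      using le[of z] mult_left_mono[OF C B0] order_trans by blast
    then show ?thesis using True by (auto simp: Lr_borel_def)
  next
    case False
    then have int: "integrable lborel (\<lambda>z. cmod (g z) powr enn2real r)" using g by (auto simp: Lr_borel_def)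
    have p: "1 \<le> enn2real r" using enn2real_ge_1[OF r False] .
    have "integrable lborel (\<lambda>z. cmod (m z * g z) powr enn2real r)"
    proof (rule Bochner_Integration.integrable_bound)
      show "integrable lborel (\<lambda>z. B powr enn2real r * cmod (g z) powr enn2real r)"
        using int by (intro integrable_mult_right)
      show "AE z in lborel. norm (cmod (m z * g z) powr enn2real r) \<le> norm (B powr enn2real r * cmod (g z) powr enn2real r)"
      proof (rule AE_I2)
        fix z
        have "cmod (m z * g z) powr enn2real r \<le> (B * cmod (g z)) powr enn2real r"
          using p le by (intro powr_mono2) auto
        then show "norm (cmod (m z * g z) powr enn2real r) \<le> norm (B powr enn2real r * cmod (g z) powr enn2real r)"
          using B0 by (simp add: powr_mult)
      qed
    qed simp
    then show ?thesis using False by (simp add: Lr_borel_def)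
  qed
qed

lemma cauchy_op_measurable:
  assumes [measurable]: "g \<in> borel_measurable borel"
  shows "cauchy_op j g \<in> borel_measurable borel"
proof -
  have "(\<lambda>z. LINT t|lborel. cauchy_kernel t * g (z - axis j t)) \<in> borel_measurable lborel"
    by (rule lborel.borel_measurable_lebesgue_integral) measurable
  then show ?thesis by (simp add: cauchy_op_def[abs_def])
qed

text \<open>Young's inequality for an integrable kernel. For finite \<open>r\<close>, Jensen's
  inequality bounds the power of the transform by a convolution of
  \<open>cmod (cauchy_kernel t)\<close> with \<open>cmod (g z) powr p\<close>, which Fubini shows to
  be integrable.\<close>

lemma Lr_borel_cauchy_op:
  assumes r: "1 \<le> r" and g: "Lr_borel r g"
  shows "Lr_borel r (cauchy_op j g)"
proof -
  have gm[measurable]: "g \<in> borel_measurable borel" using g by (rule Lr_borel_measurable)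
  note cm[measurable] = cauchy_op_measurable[OF gm, of j]
  let ?k = "\<lambda>t. cmod (cauchy_kernel t)"
  have k: "integrable lborel ?k" using integrable_cauchy_kernel by (rule integrable_norm)
  show ?thesis
  proof (cases "r = \<infinity>")
    case True
    then obtain C where C: "\<And>z. cmod (g z) \<le> C" using g by (auto simp: Lr_borel_def)
    have "cmod (cauchy_op j g z) \<le> (LINT t|lborel. ?k t * C)" for z
      unfolding cauchy_op_def
    proof (rule Bochner_Integration.integral_norm_bound_integral)
      show "integrable lborel (\<lambda>t. cauchy_kernel t * g (z - axis j t))"
        using C by (intro integrable_kernel_mult) auto
      show "integrable lborel (\<lambda>t. ?k t * C)" using k by (intro integrable_mult_left)
      show "norm (cauchy_kernel t * g (z - axis j t)) \<le> ?k t * C" for t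
        unfolding norm_mult by (intro mult_left_mono C) simp
    qed
    then show ?thesis using True cm by (auto simp: Lr_borel_def)
  next
    case False
    define p where "p = enn2real r"
    have p: "1 \<le> p" using enn2real_ge_1[OF r False] by (simp add: p_def)
    have int: "integrable lborel (\<lambda>z. cmod (g z) powr p)" using g False by (auto simp: Lr_borel_def p_def)
    define c where "c = (LINT t|lborel. ?k t) + 1"
    define J where "J z = (LINT t|lborel. ?k t * cmod (g (z - axis j t)) powr p)" for z
    have pair: "integrable (lborel \<Otimes>\<^sub>M lborel) (case_prod (\<lambda>t z. ?k t * cmod (g (z - axis j t)) powr p))"
      using integrable_conv_pair[OF k int, of j] by simp
    have "integrable lborel (\<lambda>z. cmod (cauchy_op j g z) powr p)"
    proof (rule Bochner_Integration.integrable_bound)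
      show "integrable lborel (\<lambda>z. c powr (p - 1) * J z)"
        unfolding J_def by (intro integrable_mult_right lborel_pair.integrable_snd[OF pair])
      \<comment> \<open>Fubini makes the slice integrable for almost every \<open>z\<close> only,
        and Jensen's inequality is applied there.\<close>
      show "AE z in lborel. norm (cmod (cauchy_op j g z) powr p) \<le> norm (c powr (p - 1) * J z)"
        using lborel_pair.AE_integrable_snd[OF pair]
      proof (rule eventually_mono)
        fix z assume z: "integrable lborel (\<lambda>t. ?k t * cmod (g (z - axis j t)) powr p)"
        have J0: "0 \<le> J z" unfolding J_def by (intro integral_nonneg_AE) auto
        note jen = weighted_powr_jensen[OF p k norm_ge_zero _ norm_ge_zero z, folded c_def J_def]
        have "cmod (cauchy_op j g z) \<le> (LINT t|lborel. cmod (cauchy_kernel t * g (z - axis j t)))"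
          unfolding cauchy_op_def by (rule integral_norm_bound)
        also have "\<dots> = (LINT t|lborel. ?k t * cmod (g (z - axis j t)))"
          by (simp only: norm_mult)
        finally have "cmod (cauchy_op j g z) powr p \<le> (LINT t|lborel. ?k t * cmod (g (z - axis j t))) powr p"
          using p by (intro powr_mono2) auto
        also have "\<dots> \<le> c powr (p - 1) * J z"
          by (rule jen(2)) measurable
        finally show "norm (cmod (cauchy_op j g z) powr p) \<le> norm (c powr (p - 1) * J z)"
          by simp
      qed
    qed simp
    then show ?thesis using False cm by (simp add: Lr_borel_def p_def)
  qed
qed

section \<open>Solving the equation on the polydisc\<close>

definition closed_polydisc :: "real \<Rightarrow> (complex^'n) set" where
  "closed_polydisc b = {z. \<forall>k. cmod (z $ k) \<le> b}"

lemma compact_closed_polydisc: "compact (closed_polydisc b :: (complex^'n) set)"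
proof -
  have "closed (closed_polydisc b :: (complex^'n) set)"
    unfolding closed_polydisc_def by (intro closed_Collect_all closed_Collect_le continuous_intros)
  moreover have "norm z \<le> (\<Sum>k\<in>(UNIV::'n set). b)" if "z \<in> closed_polydisc b" for z :: "complex^'n"
  proof -
    have "norm z \<le> (\<Sum>k\<in>UNIV. cmod (z $ k))"
      unfolding norm_vec_def by (intro L2_set_le_sum) simp
    also have "\<dots> \<le> (\<Sum>k\<in>(UNIV::'n set). b)"
      using that by (intro sum_mono) (auto simp: closed_polydisc_def)
    finally show ?thesis .
  qed
  ultimately show ?thesis
    unfolding compact_eq_bounded_closed bounded_iff by blast
qed

lemma closed_polydisc_subset_polydisc: "b < 1 \<Longrightarrow> closed_polydisc b \<subseteq> polydisc"
  by (auto simp: closed_polydisc_def polydisc_def intro: le_less_trans)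

lemma open_polydisc: "open (polydisc :: (complex^'n) set)"
proof -
  have "open (\<Inter>j. {z::complex^'n. cmod (z $ j) < 1})"
    by (intro open_INT ballI open_coord_less finite)
  also have "(\<Inter>j. {z::complex^'n. cmod (z $ j) < 1}) = polydisc" by (auto simp: polydisc_def)
  finally show ?thesis .
qed

text \<open>A smooth \<open>m\<close> may be unbounded on the whole space, but the product vanishes
  off a compact polydisc, so \<open>m\<close> may be replaced by its restriction to it.\<close>

lemma Lr_borel_smooth_mult:
  fixes g :: "complex^'n \<Rightarrow> complex"
  assumes r: "1 \<le> r" and g: "Lr_borel r g" and m: "smooth_fun m"
    and supp: "\<And>z. m z * g z \<noteq> 0 \<Longrightarrow> z \<in> closed_polydisc b"
  shows "Lr_borel r (\<lambda>z. m z * g z)"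
proof -
  have [measurable]: "closed_polydisc b \<in> sets (borel :: (complex^'n) measure)"
    by (intro borel_closed compact_imp_closed compact_closed_polydisc)
  have [measurable]: "m \<in> borel_measurable borel" by (rule smooth_fun_borel_measurable[OF m])
  let ?m = "\<lambda>z. indicator (closed_polydisc b) z * m z"
  have "bounded (m ` closed_polydisc b)"
    by (intro compact_imp_bounded compact_continuous_image smooth_fun_continuous_on m compact_closed_polydisc)
  then obtain B where B: "\<And>z. z \<in> closed_polydisc b \<Longrightarrow> cmod (m z) \<le> B"
    unfolding bounded_iff by (metis imageI)
  have "cmod (?m z) \<le> max 0 B" for z
    using B[of z] by (cases "z \<in> closed_polydisc b") (auto simp: le_max_iff_disj)
  then have "Lr_borel r (\<lambda>z. ?m z * g z)"
    by (intro Lr_borel_bounded_mult[OF g r]) auto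
  also have "(\<lambda>z. ?m z * g z) = (\<lambda>z. m z * g z)"
    using supp by (auto simp: fun_eq_iff indicator_def)
  finally show ?thesis .
qed

text \<open>Expresses that the transform spreads supports along coordinate \<open>j\<close>
  only.\<close>

lemma cauchy_op_nonzero:
  assumes "cauchy_op j g z \<noteq> 0"
  obtains t where "g (z - axis j t) \<noteq> 0"
proof (rule ccontr)
  assume "\<not> thesis"
  then have "g (z - axis j t) = 0" for t using that by blast
  then show False using assms by (simp add: cauchy_op_def)
qed

lemma Lr_borel_integrable_polydisc:
  assumes r: "1 \<le> r" and g: "Lr_borel r g"
    and supp: "\<And>z. g z \<noteq> 0 \<Longrightarrow> z \<in> closed_polydisc b"
  shows "integrable lborel g"
proof -
  obtain R where R: "\<And>z::complex^'a. z \<in> closed_polydisc b \<Longrightarrow> norm z \<le> R"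
    using compact_imp_bounded[OF compact_closed_polydisc[of b]] unfolding bounded_iff by blast
  show ?thesis
    by (rule Lr_borel_integrable[OF r g, of R]) (use R supp in force)
qed

section \<open>The step in one coordinate and its iteration\<close>

context
  fixes a b :: real and r :: ennreal
  assumes ab: "0 < a" "a < b" "b < 1" and r: "1 \<le> r"
begin

text \<open>\<open>\<sigma> k\<close> bounds the support of \<open>g\<close> in coordinate
  \<open>k\<close>; the step relaxes it to \<open>b\<close> in coordinate \<open>j\<close> and
  leaves the others alone. The last two claims are the weak form of \<open>g = dzbar j H + G\<close>
  and the transposition that later carries orthogonality from \<open>g\<close> to
  \<open>G\<close>.\<close>

lemma cauchy_step:
  fixes g :: "complex^'n \<Rightarrow> complex" and \<sigma> :: "'n \<Rightarrow> real"
  assumes g: "Lr_borel r g" and g_supp: "\<forall>z k. g z \<noteq> 0 \<longrightarrow> cmod (z $ k) \<le> \<sigma> k"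
    and \<sigma>: "\<sigma> j \<le> a" "\<And>k. \<sigma> k \<le> b"
  defines "\<theta> \<equiv> coord_cutoff a b j"
  defines "H \<equiv> (\<lambda>z. \<theta> z * cauchy_op j g z)"
  defines "G \<equiv> (\<lambda>z. - dzbar j \<theta> z * cauchy_op j g z)"
  shows "Lr_borel r H" "Lr_borel r G"
    and "\<And>z k. H z \<noteq> 0 \<Longrightarrow> cmod (z $ k) \<le> (\<sigma>(j := b)) k"
    and "\<And>z k. G z \<noteq> 0 \<Longrightarrow> cmod (z $ k) \<le> (\<sigma>(j := b)) k"
    and "\<And>\<phi>. \<phi> \<in> test_functions polydisc \<Longrightarrow>
      (LINT z|lborel. g z * \<phi> z) = - (LINT z|lborel. H z * dzbar j \<phi> z) + (LINT z|lborel. G z * \<phi> z)"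
    and "\<And>h. h \<in> test_functions UNIV \<Longrightarrow>
      (LINT z|lborel. G z * h z) = - (LINT z|lborel. g z * cauchy_adj j (\<lambda>z. dzbar j \<theta> z * h z) z)"
proof -
  note ab' = ab(1,2) and supp = g_supp[rule_format]
  have \<theta>: "smooth_fun \<theta>" unfolding \<theta>_def by (rule smooth_fun_coord_cutoff[OF ab'])
  have d\<theta>: "smooth_fun (dzbar j \<theta>)" by (rule smooth_fun_dzbar[OF \<theta>])
  have Csupp: "cmod (z $ k) \<le> \<sigma> k" if "cauchy_op j g z \<noteq> 0" "k \<noteq> j" for z k
  proof -
    obtain t where "g (z - axis j t) \<noteq> 0" using cauchy_op_nonzero[OF \<open>cauchy_op j g z \<noteq> 0\<close>] .
    from supp[OF this, of k] show ?thesis using that by (simp add: axis_def)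
  qed
  show Hs: "cmod (z $ k) \<le> (\<sigma>(j := b)) k" if "H z \<noteq> 0" for z k
    using that Csupp[of z k] coord_cutoff_eq_0[OF ab', of z j]
    by (cases "k = j"; cases "b \<le> cmod (z $ j)") (auto simp: H_def \<theta>_def)
  show Gs: "cmod (z $ k) \<le> (\<sigma>(j := b)) k" if "G z \<noteq> 0" for z k
    using that Csupp[of z k] dzbar_coord_cutoff_outer[OF ab', of z j j]
    by (cases "k = j"; cases "b < cmod (z $ j)") (auto simp: G_def \<theta>_def)
  have \<sigma>b: "(\<sigma>(j := b)) k \<le> b" for k using \<sigma>(2) by simp
  show "Lr_borel r H" unfolding H_def
  proof (rule Lr_borel_smooth_mult[OF r Lr_borel_cauchy_op[OF r g] \<theta>, where b=b])
    show "z \<in> closed_polydisc b" if "\<theta> z * cauchy_op j g z \<noteq> 0" for z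
      using order_trans[OF Hs \<sigma>b] that by (simp add: H_def closed_polydisc_def)
  qed
  show "Lr_borel r G" unfolding G_def
  proof (rule Lr_borel_smooth_mult[OF r Lr_borel_cauchy_op[OF r g] smooth_fun_minus[OF d\<theta>], where b=b])
    show "z \<in> closed_polydisc b" if "- dzbar j \<theta> z * cauchy_op j g z \<noteq> 0" for z
      using order_trans[OF Gs \<sigma>b] that by (simp add: G_def closed_polydisc_def)
  qed
  have intg: "integrable lborel g"
    by (rule Lr_borel_integrable_polydisc[OF r g, of b])
      (use order_trans[OF supp \<sigma>(2)] in \<open>auto simp: closed_polydisc_def\<close>)
  have dual: "(LINT z|lborel. cauchy_op j g z * u z) = (LINT z|lborel. g z * cauchy_adj j u z)"
    "integrable lborel (\<lambda>z. cauchy_op j g z * u z)" if u: "u \<in> test_functions UNIV" for u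
  proof -
    obtain M where M: "\<And>z. cmod (u z) \<le> M" using test_function_bounded[OF u] by blast
    have um: "u \<in> borel_measurable borel" by (intro smooth_fun_borel_measurable test_functions_smooth[OF u])
    show "(LINT z|lborel. cauchy_op j g z * u z) = (LINT z|lborel. g z * cauchy_adj j u z)"
      "integrable lborel (\<lambda>z. cauchy_op j g z * u z)"
      using cauchy_op_duality[OF intg um M] by auto
  qed
  show "(LINT z|lborel. G z * h z) = - (LINT z|lborel. g z * cauchy_adj j (\<lambda>z. dzbar j \<theta> z * h z) z)"
    if h: "h \<in> test_functions UNIV" for h
  proof -
    have "(LINT z|lborel. G z * h z) = (LINT z|lborel. - (cauchy_op j g z * (dzbar j \<theta> z * h z)))"
      by (simp add: G_def ac_simps)
    also have "\<dots> = - (LINT z|lborel. cauchy_op j g z * (dzbar j \<theta> z * h z))"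
      by (rule Bochner_Integration.integral_minus)
    finally show ?thesis using dual(1)[OF test_functions_mult[OF h d\<theta>]] by simp
  qed
  show "(LINT z|lborel. g z * \<phi> z) = - (LINT z|lborel. H z * dzbar j \<phi> z) + (LINT z|lborel. G z * \<phi> z)"
    if \<phi>: "\<phi> \<in> test_functions polydisc" for \<phi>
  proof -
    have \<phi>': "\<phi> \<in> test_functions UNIV" using test_functions_mono[OF \<phi>] by simp
    let ?\<psi> = "\<lambda>z. \<theta> z * \<phi> z"
    have \<psi>: "?\<psi> \<in> test_functions UNIV" by (rule test_functions_mult[OF \<phi>' \<theta>])
    have "- (LINT z|lborel. H z * dzbar j \<phi> z) + (LINT z|lborel. G z * \<phi> z)
       = - ((LINT z|lborel. cauchy_op j g z * (\<theta> z * dzbar j \<phi> z)) + (LINT z|lborel. cauchy_op j g z * (dzbar j \<theta> z * \<phi> z)))"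
    proof -
      have "(LINT z|lborel. G z * \<phi> z) = - (LINT z|lborel. cauchy_op j g z * (dzbar j \<theta> z * \<phi> z))"
        unfolding Bochner_Integration.integral_minus[symmetric] by (simp add: G_def ac_simps)
      then show ?thesis by (simp add: H_def ac_simps)
    qed
    also have "\<dots> = - (LINT z|lborel. cauchy_op j g z * (\<theta> z * dzbar j \<phi> z) + cauchy_op j g z * (dzbar j \<theta> z * \<phi> z))"
      using dual(2)[OF test_functions_mult[OF dzbar_test_function[OF \<phi>'] \<theta>]]
        dual(2)[OF test_functions_mult[OF \<phi>' d\<theta>]]
      by (subst Bochner_Integration.integral_add) auto
    \<comment> \<open>The product rule merges both terms into the derivative of
      \<open>\<theta> z * \<phi> z\<close>.\<close>
    also have "\<dots> = - (LINT z|lborel. cauchy_op j g z * dzbar j ?\<psi> z)"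
      by (simp only: dzbar_mult[OF \<theta> test_functions_smooth[OF \<phi>]] distrib_left add.commute)
    also have "\<dots> = - (LINT z|lborel. g z * cauchy_adj j (dzbar j ?\<psi>) z)"
      by (subst dual(1)[OF dzbar_test_function[OF \<psi>]]) simp
    \<comment> \<open>Only points with \<open>g z \<noteq> 0\<close> contribute. There
      \<open>cmod (z $ j) \<le> a\<close>, so \<open>\<theta> z = 1\<close> and the adjoint of the
      derivative returns \<open>- \<phi> z\<close>.\<close>
    also have "\<dots> = (LINT z|lborel. g z * \<phi> z)"
      unfolding Bochner_Integration.integral_minus[symmetric]
    proof (rule Bochner_Integration.integral_cong[OF refl])
      fix z
      show "- (g z * cauchy_adj j (dzbar j ?\<psi>) z) = g z * \<phi> z"
      proof (cases "g z = 0")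
        case False
        then have zj: "cmod (z $ j) \<le> a" using supp[OF False, of j] \<sigma>(1) by linarith
        have "cauchy_adj j (dzbar j ?\<psi>) z = - ?\<psi> z"
        proof (rule cauchy_adj_dzbar[OF \<psi>])
          fix t :: complex assume t: "3 < cmod t"
          have "cmod t \<le> cmod (z $ j + t) + cmod (z $ j)"
            using norm_triangle_ineq4[of "z $ j + t" "z $ j"] by simp
          then have "b \<le> cmod ((z + axis j t) $ j)" using t zj ab by (simp add: axis_def)
          then show "\<theta> (z + axis j t) * \<phi> (z + axis j t) = 0"
            unfolding \<theta>_def by (subst coord_cutoff_eq_0[OF ab']) auto
        qed
        moreover have "\<theta> z = 1" unfolding \<theta>_def by (rule coord_cutoff_eq_1[OF ab' zj])
        ultimately show ?thesis by simp
      qed simp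
    qed
    finally show ?thesis by simp
  qed
qed

text \<open>\<open>S\<close> holds the coordinates already treated. Coordinates outside
  \<open>S\<close> keep the radius \<open>\<rho> < a\<close> that the next step requires, and they
  alone impose conditions on the functions \<open>h\<close>; once \<open>S\<close> is everything, no
  condition remains.\<close>

lemma cauchy_decomposition:
  fixes f :: "complex^'n \<Rightarrow> complex"
  assumes f: "Lr_borel r f" and \<rho>: "\<rho> < a" and supp: "\<And>z k. f z \<noteq> 0 \<Longrightarrow> cmod (z $ k) \<le> \<rho>"
    and orth: "\<And>h. h \<in> test_functions UNIV \<Longrightarrow> (\<And>i z. cmod (z $ i) < a \<Longrightarrow> dzbar i h z = 0) \<Longrightarrow>
      (LINT z|lborel. f z * h z) = 0"
    and S: "finite S"
  shows "\<exists>g H. Lr_borel r g \<and> (\<forall>z k. g z \<noteq> 0 \<longrightarrow> cmod (z $ k) \<le> (if k \<in> S then b else \<rho>)) \<and>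
     (\<forall>j\<in>S. Lr_borel r (H j) \<and> (\<forall>z k. H j z \<noteq> 0 \<longrightarrow> cmod (z $ k) \<le> b)) \<and>
     (\<forall>\<phi>\<in>test_functions polydisc. (LINT z|lborel. f z * \<phi> z) =
        - (\<Sum>j\<in>S. LINT z|lborel. H j z * dzbar j \<phi> z) + (LINT z|lborel. g z * \<phi> z)) \<and>
     (\<forall>h\<in>test_functions UNIV. (\<forall>i z. i \<notin> S \<longrightarrow> cmod (z $ i) < a \<longrightarrow> dzbar i h z = 0) \<longrightarrow>
        (LINT z|lborel. g z * h z) = 0)"
  using S
proof (induction S rule: finite_induct)
  case empty
  show ?case
    \<comment> \<open>With no coordinate treated, the remainder is \<open>f\<close> itself and any
      family serves as \<open>H\<close>.\<close>
    by (rule exI[of _ f], rule exI[of _ undefined]) (use f supp orth in auto)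
next
  case (insert j S)
  then obtain g H where g: "Lr_borel r g" "\<And>z k. g z \<noteq> 0 \<Longrightarrow> cmod (z $ k) \<le> (if k \<in> S then b else \<rho>)"
    and H: "\<And>j. j \<in> S \<Longrightarrow> Lr_borel r (H j)" "\<And>j z k. j \<in> S \<Longrightarrow> H j z \<noteq> 0 \<Longrightarrow> cmod (z $ k) \<le> b"
    and dec: "\<And>\<phi>. \<phi> \<in> test_functions polydisc \<Longrightarrow> (LINT z|lborel. f z * \<phi> z) =
        - (\<Sum>j\<in>S. LINT z|lborel. H j z * dzbar j \<phi> z) + (LINT z|lborel. g z * \<phi> z)"
    and og: "\<And>h. h \<in> test_functions UNIV \<Longrightarrow> (\<And>i z. i \<notin> S \<Longrightarrow> cmod (z $ i) < a \<Longrightarrow> dzbar i h z = 0) \<Longrightarrow>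
        (LINT z|lborel. g z * h z) = 0"
    by blast
  define \<sigma> where "\<sigma> k = (if k \<in> S then b else \<rho>)" for k
  have \<sigma>: "\<sigma> j \<le> a" "\<And>k. \<sigma> k \<le> b" using insert.hyps \<rho> ab by (auto simp: \<sigma>_def)
  let ?\<theta> = "coord_cutoff a b j"
  define Hj where "Hj z = ?\<theta> z * cauchy_op j g z" for z
  define G where "G z = - dzbar j ?\<theta> z * cauchy_op j g z" for z
  have gs: "\<forall>z k. g z \<noteq> 0 \<longrightarrow> cmod (z $ k) \<le> \<sigma> k"
    using g(2) by (simp add: \<sigma>_def)
  note step = cauchy_step[OF g(1) gs \<sigma>, folded Hj_def G_def]
  note ab' = ab(1,2)
  have \<sigma>j: "(\<sigma>(j := b)) k = (if k \<in> insert j S then b else \<rho>)" for k by (simp add: \<sigma>_def)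
  have \<sigma>j': "(\<sigma>(j := b)) k \<le> b" for k using \<sigma> by simp
  show ?case
  proof (intro exI[of _ G] exI[of _ "H(j := Hj)"] conjI ballI allI impI)
    show "Lr_borel r G" by (rule step(2))
    show "cmod (z $ k) \<le> (if k \<in> insert j S then b else \<rho>)" if "G z \<noteq> 0" for z k
      using step(4)[OF that, of k] unfolding \<sigma>j .
    show "Lr_borel r ((H(j := Hj)) i)" if "i \<in> insert j S" for i
      using that H(1) step(1) by auto
    show "cmod (z $ k) \<le> b" if "i \<in> insert j S" "(H(j := Hj)) i z \<noteq> 0" for i z k
      using that H(2)[of i z k] order_trans[OF step(3) \<sigma>j'] by (auto split: if_splits)
    show "(LINT z|lborel. f z * \<phi> z) = - (\<Sum>i\<in>insert j S. LINT z|lborel. (H(j := Hj)) i z * dzbar i \<phi> z)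
        + (LINT z|lborel. G z * \<phi> z)" if \<phi>: "\<phi> \<in> test_functions polydisc" for \<phi>
    proof -
      have "(\<Sum>i\<in>S. LINT z|lborel. (H(j := Hj)) i z * dzbar i \<phi> z) = (\<Sum>i\<in>S. LINT z|lborel. H i z * dzbar i \<phi> z)"
        using insert.hyps by (intro sum.cong) auto
      then show ?thesis using dec[OF \<phi>] step(5)[OF \<phi>] insert.hyps by simp
    qed
    fix h :: "complex^'n \<Rightarrow> complex" assume h: "h \<in> test_functions UNIV"
      and hol: "\<forall>i z. i \<notin> insert j S \<longrightarrow> cmod (z $ i) < a \<longrightarrow> dzbar i h z = 0"
    \<comment> \<open>By transposition, pairing \<open>G\<close> with \<open>h\<close> is minus
      pairing \<open>g\<close> with the adjoint of \<open>u\<close>. It remains to see that this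
      adjoint meets the conditions for \<open>S\<close>, which include a new one in coordinate
      \<open>j\<close>.\<close>
    define u where "u z = dzbar j ?\<theta> z * h z" for z
    have \<theta>: "smooth_fun (dzbar j ?\<theta>)" by (intro smooth_fun_dzbar smooth_fun_coord_cutoff ab')
    have u: "u \<in> test_functions UNIV" unfolding u_def by (rule test_functions_mult[OF h \<theta>])
    have "(LINT z|lborel. g z * cauchy_adj j u z) = 0"
    proof (rule og[OF cauchy_adj_test_function[OF u]])
      fix i z assume i: "i \<notin> S" and z: "cmod (z $ i) < a"
      show "dzbar i (cauchy_adj j u) z = 0"
      proof (cases "i = j")
        case True
        \<comment> \<open>The new condition: the derivative of the adjoint is \<open>- u\<close>,
          and \<open>u\<close> vanishes for \<open>cmod (z $ j) < a\<close> because the cutoff is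
          constant there.\<close>
        have "cauchy_adj j (dzbar j u) z = - u z"
        proof (rule cauchy_adj_dzbar[OF u])
          fix t :: complex assume t: "3 < cmod t"
          have "cmod t \<le> cmod (z $ j + t) + cmod (z $ j)"
            using norm_triangle_ineq4[of "z $ j + t" "z $ j"] by simp
          then have "b < cmod ((z + axis j t) $ j)" using t z True ab by (simp add: axis_def)
          then show "u (z + axis j t) = 0"
            unfolding u_def by (subst dzbar_coord_cutoff_outer[OF ab']) auto
        qed
        moreover have "u z = 0"
          unfolding u_def using z True by (subst dzbar_coord_cutoff_inner[OF ab']) auto
        ultimately show ?thesis using dzbar_cauchy_adj[OF u] True by simp
      next
        case False
        \<comment> \<open>A remaining coordinate: the shift leaves \<open>z $ i\<close> unchanged,
          so the condition on \<open>h\<close> holds along the whole line of integration.\<close>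
        have "dzbar i u (z + axis j t) = 0" for t
        proof -
          have "dzbar i h (z + axis j t) = 0" using hol i False z by (simp add: axis_def)
          then show ?thesis
            unfolding u_def dzbar_mult[OF \<theta> test_functions_smooth[OF h]]
            by (simp add: dzbar_dzbar_coord_cutoff[OF ab' False])
        qed
        then show ?thesis
          unfolding dzbar_cauchy_adj[OF u] cauchy_adj_def by simp
      qed
    qed
    then show "(LINT z|lborel. G z * h z) = 0" using step(6)[OF h] unfolding u_def by simp
  qed
qed

end

section \<open>From classes on the polydisc to Borel functions and back\<close>

lemma compact_subset_closed_polydisc:
  fixes S :: "(complex^'n) set"
  assumes S: "compact S" "S \<subseteq> polydisc"
  obtains \<rho> where "0 < \<rho>" "\<rho> < 1" "S \<subseteq> closed_polydisc \<rho>"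
proof (cases "S = {}")
  case True
  then show ?thesis using that[of "1/2"] by simp
next
  case False
  have "\<exists>w\<in>S. \<forall>z\<in>S. cmod (z $ j) \<le> cmod (w $ j)" for j
    by (rule continuous_attains_sup[OF S(1) False]) (intro continuous_intros)
  then obtain w where w: "\<And>j. w j \<in> S" "\<And>j z. z \<in> S \<Longrightarrow> cmod (z $ j) \<le> cmod (w j $ j)"
    by metis
  \<comment> \<open>The entry 1/2 keeps \<rho> positive.\<close>
  define \<rho> where "\<rho> = Max (insert (1/2) (range (\<lambda>j. cmod (w j $ j))))"
  have "1/2 \<le> \<rho>" unfolding \<rho>_def by (intro Max_ge) auto
  moreover have "\<rho> < 1"
    unfolding \<rho>_def using w(1) S(2) by (subst Max_less_iff) (auto simp: polydisc_def subset_iff)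
  moreover have "S \<subseteq> closed_polydisc \<rho>"
  proof
    fix z assume z: "z \<in> S"
    have "cmod (w j $ j) \<le> \<rho>" for j unfolding \<rho>_def by (intro Max_ge) auto
    then show "z \<in> closed_polydisc \<rho>"
      using order_trans[OF w(2)[OF z]] by (auto simp: closed_polydisc_def)
  qed
  ultimately show ?thesis using that[of \<rho>] by simp
qed

text \<open>The set is a union of possibly uncountably many open sets on which \<open>f\<close>
  vanishes almost everywhere; Lindelof's theorem selects countably many with the same union.\<close>

lemma AE_zero_off_ess_support:
  assumes "open \<Omega>"
  shows "AE x in lebesgue. x \<in> \<Omega> - ess_support \<Omega> f \<longrightarrow> f x = 0"
proof -
  define \<U> where "\<U> = {U. open U \<and> U \<subseteq> \<Omega> \<and> (AE y in lebesgue_on U. f y = 0)}"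
  have "\<And>S. S \<in> \<U> \<Longrightarrow> open S" by (auto simp: \<U>_def)
  then obtain \<V> where \<V>: "\<V> \<subseteq> \<U>" "countable \<V>" "\<Union>\<V> = \<Union>\<U>" using Lindelof[of \<U>] by blast
  have "AE x in lebesgue. \<forall>U\<in>\<V>. x \<in> U \<longrightarrow> f x = 0"
  proof (subst AE_ball_countable[OF \<V>(2)], intro ballI)
    fix U assume "U \<in> \<V>"
    then have U: "open U" "AE y in lebesgue_on U. f y = 0" using \<V>(1) by (auto simp: \<U>_def)
    then show "AE x in lebesgue. x \<in> U \<longrightarrow> f x = 0"
      by (subst (asm) AE_restrict_space_iff) auto
  qed
  then show ?thesis
  proof (rule eventually_mono)
    fix x assume x: "\<forall>U\<in>\<V>. x \<in> U \<longrightarrow> f x = 0"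
    show "x \<in> \<Omega> - ess_support \<Omega> f \<longrightarrow> f x = 0"
    proof
      assume "x \<in> \<Omega> - ess_support \<Omega> f"
      then have "x \<in> \<Union>\<U>" by (auto simp: ess_support_def \<U>_def)
      then show "f x = 0" using x \<V>(3) by blast
    qed
  qed
qed

lemma lebesgue_ex_borel_complex:
  fixes f :: "'a::euclidean_space \<Rightarrow> complex"
  assumes [measurable]: "f \<in> borel_measurable lebesgue"
  obtains g where "g \<in> borel_measurable borel" "AE x in lborel. f x = g x"
proof -
  have m: "(\<lambda>x. Re (f x)) \<in> borel_measurable lebesgue" "(\<lambda>x. Im (f x)) \<in> borel_measurable lebesgue"
    by measurable
  obtain g1 where g1: "g1 \<in> borel_measurable lborel" "AE x in lborel. Re (f x) = g1 x"
    using completion_ex_borel_measurable_real[OF m(1)] by blast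
  obtain g2 where g2: "g2 \<in> borel_measurable lborel" "AE x in lborel. Im (f x) = g2 x"
    using completion_ex_borel_measurable_real[OF m(2)] by blast
  have [measurable]: "g1 \<in> borel_measurable borel" "g2 \<in> borel_measurable borel" using g1 g2 by auto
  have "(\<lambda>x. complex_of_real (g1 x) + \<i> * complex_of_real (g2 x)) \<in> borel_measurable borel" by measurable
  moreover have "AE x in lborel. f x = complex_of_real (g1 x) + \<i> * complex_of_real (g2 x)"
    using g1(2) g2(2) by eventually_elim (simp add: complex_eq_iff)
  ultimately show ?thesis by (rule that)
qed

text \<open>Changing the coefficient on a null set makes it Borel, zero at every point off the
  smaller polydisc and, for \<open>r = \<infinity>\<close>, bounded everywhere; integrals against
  Borel functions do not notice.\<close>

lemma in_Lr_borel_representative: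
  fixes f :: "complex^'n \<Rightarrow> complex"
  assumes r: "1 \<le> r" and f: "in_Lr r polydisc f" and supp: "ess_support polydisc f \<subseteq> closed_polydisc \<rho>"
  obtains g where "Lr_borel r g" "\<And>z. g z \<noteq> 0 \<Longrightarrow> z \<in> closed_polydisc \<rho>"
    "\<And>\<phi>. \<phi> \<in> borel_measurable borel \<Longrightarrow> distr_of_fun polydisc f \<phi> = (LINT z|lborel. g z * \<phi> z)"
proof -
  have pd[measurable]: "(polydisc :: (complex^'n) set) \<in> sets lebesgue"
    by (intro sets_completionI_sets lborelD borel_open open_polydisc)
  define f1 where "f1 z = (if z \<in> polydisc then f z else 0)" for z
  have f1[measurable]: "f1 \<in> borel_measurable lebesgue"
    unfolding f1_def using f by (subst borel_measurable_if) (auto simp: in_Lr_def)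
  obtain g0 where g0[measurable]: "g0 \<in> borel_measurable borel" and g0_eq: "AE z in lborel. f1 z = g0 z"
    using lebesgue_ex_borel_complex[OF f1] .
  have "\<exists>C. r = \<infinity> \<longrightarrow> (AE z in lborel. cmod (f1 z) \<le> C)"
  proof (cases "r = \<infinity>")
    case True
    then obtain C where "AE z in lebesgue_on polydisc. cmod (f z) \<le> C" using f by (auto simp: in_Lr_def)
    then have "AE z in lebesgue. z \<in> polydisc \<longrightarrow> cmod (f z) \<le> C"
      by (subst (asm) AE_restrict_space_iff) (use pd in auto)
    then have "AE z in lborel. cmod (f1 z) \<le> max 0 C"
      unfolding AE_completion_iff by eventually_elim (auto simp: f1_def)
    then show ?thesis by blast
  qed simp
  then obtain C where C: "r = \<infinity> \<Longrightarrow> AE z in lborel. cmod (f1 z) \<le> C" by blast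
  \<comment> \<open>Off \<open>A\<close> the function \<open>g0\<close> is nonzero only on a null
    set, so it may be replaced by 0 there.\<close>
  define A where "A = closed_polydisc \<rho> \<inter> {z. r = \<infinity> \<longrightarrow> cmod (g0 z) \<le> C}"
  define g where "g z = (if z \<in> A then g0 z else 0)" for z
  have [measurable]: "closed_polydisc \<rho> \<in> sets (borel :: (complex^'n) measure)"
    by (intro borel_closed compact_imp_closed compact_closed_polydisc)
  have [measurable]: "A \<in> sets borel" unfolding A_def by (cases "r = \<infinity>") auto
  have gm[measurable]: "g \<in> borel_measurable borel" unfolding g_def by measurable
  have eq: "AE z in lborel. f1 z = g z"
  proof -
    have "AE z in lborel. z \<in> polydisc - ess_support polydisc f \<longrightarrow> f z = 0"
      using AE_zero_off_ess_support[OF open_polydisc, of f] unfolding AE_completion_iff .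
    moreover have "AE z in lborel. r = \<infinity> \<longrightarrow> cmod (f1 z) \<le> C" using C by (cases "r = \<infinity>") auto
    ultimately show ?thesis using g0_eq
    proof eventually_elim
      case (elim z)
      show ?case
      proof (cases "z \<in> closed_polydisc \<rho>")
        case True
        then show ?thesis using elim(2,3) by (auto simp: g_def A_def)
      next
        case False
        then have "f1 z = 0" using elim(1) supp by (auto simp: f1_def)
        then show ?thesis using False by (simp add: g_def A_def)
      qed
    qed
  qed
  have eq': "AE z in lebesgue. f1 z = g z" using eq by (simp add: AE_completion_iff)
  have gl[measurable]: "g \<in> borel_measurable lebesgue" using gm by (intro measurable_completion) simp
  have "Lr_borel r g"
  proof (cases "r = \<infinity>")
    case True
    have "cmod (g z) \<le> max 0 C" for z using True by (auto simp: g_def A_def)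
    then show ?thesis using True gm by (auto simp: Lr_borel_def)
  next
    case False
    define p where "p = enn2real r"
    have p: "1 \<le> p" using enn2real_ge_1[OF r False] by (simp add: p_def)
    have "integrable (lebesgue_on polydisc) (\<lambda>z. cmod (f z) powr p)"
      using f False by (simp add: in_Lr_def p_def)
    then have "integrable lebesgue (\<lambda>z. indicator polydisc z *\<^sub>R (cmod (f z) powr p))"
      by (subst (asm) integrable_restrict_space) (use pd in auto)
    also have "(\<lambda>z. indicator polydisc z *\<^sub>R (cmod (f z) powr p)) = (\<lambda>z. cmod (f1 z) powr p)"
      using p by (auto simp: f1_def indicator_def fun_eq_iff)
    finally have "integrable lebesgue (\<lambda>z. cmod (g z) powr p)"
      by (rule integrable_cong_AE_imp) (use eq' in \<open>auto elim: eventually_mono\<close>)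
    then have "integrable lborel (\<lambda>z. cmod (g z) powr p)"
      by (subst (asm) integrable_completion) auto
    then show ?thesis using False gm by (simp add: Lr_borel_def p_def)
  qed
  moreover have "z \<in> closed_polydisc \<rho>" if "g z \<noteq> 0" for z
    using that by (auto simp: g_def A_def split: if_splits)
  moreover have "distr_of_fun polydisc f \<phi> = (LINT z|lborel. g z * \<phi> z)"
    if [measurable]: "\<phi> \<in> borel_measurable borel" for \<phi>
  proof -
    have [measurable]: "\<phi> \<in> borel_measurable lebesgue" using that by (intro measurable_completion) simp
    have "distr_of_fun polydisc f \<phi> = (LINT z|lebesgue. indicator polydisc z *\<^sub>R (f z * \<phi> z))"
      unfolding distr_of_fun_def by (rule integral_restrict_space) (use pd in auto)
    also have "\<dots> = (LINT z|lebesgue. f1 z * \<phi> z)"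
      by (rule Bochner_Integration.integral_cong) (auto simp: f1_def indicator_def)
    also have "\<dots> = (LINT z|lebesgue. g z * \<phi> z)"
      by (rule integral_cong_AE) (use eq' in \<open>auto elim: eventually_mono\<close>)
    also have "\<dots> = (LINT z|lborel. g z * \<phi> z)"
      by (rule integral_completion) measurable
    finally show ?thesis .
  qed
  ultimately show ?thesis by (rule that)
qed

lemma Lr_borel_imp_in_Lr_c:
  fixes h :: "complex^'n \<Rightarrow> complex"
  assumes r: "1 \<le> r" and h: "Lr_borel r h" and supp: "\<And>z. h z \<noteq> 0 \<Longrightarrow> z \<in> closed_polydisc b" and b: "b < 1"
  shows "in_Lr_c r polydisc h"
    and "\<phi> \<in> borel_measurable borel \<Longrightarrow> distr_of_fun polydisc h \<phi> = (LINT z|lborel. h z * \<phi> z)"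
proof -
  have pd[measurable]: "(polydisc :: (complex^'n) set) \<in> sets lebesgue"
    by (intro sets_completionI_sets lborelD borel_open open_polydisc)
  have hm[measurable]: "h \<in> borel_measurable borel" using h by (rule Lr_borel_measurable)
  have hl[measurable]: "h \<in> borel_measurable lebesgue" using hm by (intro measurable_completion) simp
  have outside: "h z = 0" if "z \<notin> polydisc" for z
    using supp[of z] that closed_polydisc_subset_polydisc[OF b] by auto
  have "in_Lr r polydisc h"
  proof (cases "r = \<infinity>")
    case True
    then obtain C where "\<And>z. cmod (h z) \<le> C" using h by (auto simp: Lr_borel_def)
    then show ?thesis using True by (auto simp: in_Lr_def intro!: measurable_restrict_space1)
  next
    case False
    then have "integrable lborel (\<lambda>z. cmod (h z) powr enn2real r)" using h by (simp add: Lr_borel_def)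
    then have "integrable lebesgue (\<lambda>z. cmod (h z) powr enn2real r)"
      by (subst integrable_completion) auto
    moreover have "(\<lambda>z. indicator polydisc z *\<^sub>R (cmod (h z) powr enn2real r)) = (\<lambda>z. cmod (h z) powr enn2real r)"
      using outside by (auto simp: indicator_def fun_eq_iff)
    ultimately have "integrable lebesgue (\<lambda>z. indicator polydisc z *\<^sub>R (cmod (h z) powr enn2real r))"
      by simp
    then show ?thesis using False
      by (subst (asm) integrable_restrict_space[symmetric])
        (use pd in \<open>auto simp: in_Lr_def intro!: measurable_restrict_space1\<close>)
  qed
  moreover have "compact (ess_support polydisc h)"
  proof -
    \<comment> \<open>The part of the polydisc beyond radius \<open>b\<close> is one of these open
      sets, so the essential support is a compact polydisc minus an open set.\<close>
    define \<U> where "\<U> = {U. open U \<and> U \<subseteq> polydisc \<and> (AE y in lebesgue_on U. h y = 0)}"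
    let ?W = "polydisc - closed_polydisc b :: (complex^'n) set"
    have "open ?W"
      by (intro open_Diff open_polydisc compact_imp_closed compact_closed_polydisc)
    moreover have "AE y in lebesgue_on ?W. h y = 0"
      using supp by (intro AE_I2) (auto simp: space_restrict_space)
    ultimately have W: "?W \<in> \<U>" by (auto simp: \<U>_def)
    have ess: "ess_support polydisc h = polydisc - \<Union>\<U>"
      by (auto simp: ess_support_def \<U>_def)
    also have "\<dots> = closed_polydisc b - \<Union>\<U>"
      using W closed_polydisc_subset_polydisc[OF b] by blast
    finally have "ess_support polydisc h = closed_polydisc b - \<Union>\<U>" .
    moreover have "open (\<Union>\<U>)" by (auto simp: \<U>_def)
    ultimately show ?thesis by (simp add: compact_diff compact_closed_polydisc)
  qed
  ultimately show "in_Lr_c r polydisc h" by (simp add: in_Lr_c_def)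
  show "distr_of_fun polydisc h \<phi> = (LINT z|lborel. h z * \<phi> z)"
    if [measurable]: "\<phi> \<in> borel_measurable borel"
  proof -
    have "distr_of_fun polydisc h \<phi> = (LINT z|lebesgue. indicator polydisc z *\<^sub>R (h z * \<phi> z))"
      unfolding distr_of_fun_def by (rule integral_restrict_space) (use pd in auto)
    also have "\<dots> = (LINT z|lebesgue. h z * \<phi> z)"
      by (rule Bochner_Integration.integral_cong) (auto simp: indicator_def outside)
    also have "\<dots> = (LINT z|lborel. h z * \<phi> z)"
      by (rule integral_completion) measurable
    finally show ?thesis .
  qed
qed

section \<open>Orthogonality inherited from the current\<close>

lemma dbar_compact_current_orthogonal:
  fixes T :: "'n::{finite,linorder} current"
  assumes T: "current_on polydisc (CARD('n) - 1) T"
    and supp: "current_support polydisc (CARD('n) - 1) T \<subseteq> closed_polydisc \<rho>" and "\<rho> < a"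
    and \<psi>: "\<psi> \<in> test_functions polydisc"
    and hol: "\<And>j z. (\<And>i. cmod (z $ i) < a) \<Longrightarrow> dzbar j \<psi> z = 0"
  shows "dbar T UNIV \<psi> = 0"
proof -
  have "T (UNIV - {j}) (dzbar j \<psi>) = 0" for j
  proof (rule distr_vanishes_off_support[OF _ dzbar_test_function[OF \<psi>]])
    have card: "card (UNIV - {j}) = CARD('n) - 1" by (simp add: card_Diff_singleton)
    then show "distribution_on polydisc (T (UNIV - {j}))" using T by (simp add: current_on_def)
    \<comment> \<open>By holomorphy \<open>dzbar j \<psi>\<close> vanishes on the open polydisc of
      radius \<open>a\<close>, so its support lies in the closed complement; the support of
      \<open>T\<close> lies in the polydisc of radius \<open>\<rho> < a\<close>.\<close>
    let ?U = "\<Inter>i. {z::(complex, 'n) vec. cmod (z $ i) < a}"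
    have "closed (- ?U)" by (intro closed_Compl open_INT ballI open_coord_less finite)
    then have "fun_support (dzbar j \<psi>) \<subseteq> - ?U"
      by (rule fun_support_subset) (auto intro: hol)
    moreover have "distr_support polydisc (T (UNIV - {j})) \<subseteq> closed_polydisc \<rho>"
      using supp card unfolding current_support_def by blast
    moreover have "closed_polydisc \<rho> \<subseteq> ?U"
      using \<open>\<rho> < a\<close> by (auto simp: closed_polydisc_def intro: le_less_trans)
    ultimately show "fun_support (dzbar j \<psi>) \<inter> distr_support polydisc (T (UNIV - {j})) = {}" by blast
  qed
  then show ?thesis by (simp add: dbar_def distr_dzbar_def)
qed

text \<open>\<open>T\<close> accepts test functions on the polydisc only, so \<open>h\<close> is
  multiplied by cutoffs in all coordinates. The product agrees with \<open>h\<close> where all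
  coordinates have modulus at most \<open>a\<close>, which preserves both the holomorphy near the
  support of \<open>T\<close> and the pairing with \<open>g\<close>.\<close>

lemma form_orthogonal_to_holomorphic:
  fixes \<omega> :: "'n::{finite,linorder} form" and T :: "'n current"
  assumes T: "current_on polydisc (CARD('n) - 1) T"
    and supp: "current_support polydisc (CARD('n) - 1) T \<subseteq> closed_polydisc \<rho>"
    and eq: "current_eq polydisc CARD('n) (dbar T) (current_of_form polydisc \<omega>)"
    and ab: "0 < a" "\<rho> < a" "a < b" "b < 1"
    and g: "\<And>z. g z \<noteq> 0 \<Longrightarrow> z \<in> closed_polydisc \<rho>"
    and rep: "\<And>\<phi>. \<phi> \<in> borel_measurable borel \<Longrightarrow> distr_of_fun polydisc (\<omega> UNIV) \<phi> = (LINT z|lborel. g z * \<phi> z)"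
    and h: "h \<in> test_functions UNIV" and hol: "\<And>i z. cmod (z $ i) < a \<Longrightarrow> dzbar i h z = 0"
  shows "(LINT z|lborel. g z * h z) = 0"
proof -
  define \<psi> where "\<psi> z = (\<Prod>i\<in>UNIV. coord_cutoff a b i z) * h z" for z
  have sm: "smooth_fun \<psi>"
    unfolding \<psi>_def
    by (intro smooth_fun_mult smooth_fun_prod smooth_fun_coord_cutoff ab test_functions_smooth[OF h])
  have \<psi>: "\<psi> \<in> test_functions polydisc"
  proof (rule test_functionsI[OF sm compact_closed_polydisc closed_polydisc_subset_polydisc[OF ab(4)]])
    fix z :: "(complex, 'n) vec" assume "z \<notin> closed_polydisc b"
    then obtain i where "b < cmod (z $ i)" by (auto simp: closed_polydisc_def not_le)
    then have "coord_cutoff a b i z = 0" by (intro coord_cutoff_eq_0[OF ab(1,3)] less_imp_le)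
    then have "(\<Prod>i\<in>UNIV. coord_cutoff a b i z) = 0" by (intro prod_zero) auto
    then show "\<psi> z = 0" by (simp add: \<psi>_def)
  qed
  have \<psi>h: "\<psi> z = h z" if "\<And>i. cmod (z $ i) \<le> a" for z
    using coord_cutoff_eq_1[OF ab(1,3) that] by (simp add: \<psi>_def)
  have "dbar T UNIV \<psi> = 0"
  proof (rule dbar_compact_current_orthogonal[OF T supp ab(2) \<psi>])
    fix j and z :: "(complex, 'n) vec" assume z: "\<And>i. cmod (z $ i) < a"
    let ?U = "\<Inter>i. {z::(complex, 'n) vec. cmod (z $ i) < a}"
    have "open ?U" by (intro open_INT ballI open_coord_less finite)
    then have "dzbar j \<psi> z = dzbar j h z"
      by (rule dzbar_cong_open) (auto intro!: \<psi>h less_imp_le z)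
    then show "dzbar j \<psi> z = 0" using hol z by simp
  qed
  then have "distr_of_fun polydisc (\<omega> UNIV) \<psi> = 0"
    using eq \<psi> by (simp add: current_eq_def current_of_form_def)
  then have "(LINT z|lborel. g z * \<psi> z) = 0"
    using rep[OF smooth_fun_borel_measurable[OF sm]] by simp
  moreover have "g z * \<psi> z = g z * h z" for z
  proof (cases "g z = 0")
    case False
    have "cmod (z $ i) \<le> a" for i
      using g[OF False] ab(2) by (auto simp: closed_polydisc_def intro: order_trans less_imp_le)
    then show ?thesis using \<psi>h by simp
  qed simp
  ultimately show ?thesis by simp
qed

theorem theorem6p2:
  fixes r :: ennreal
    and \<omega> :: "'n::{finite,linorder} form"
  assumes "1 \<le> r"
    and "Lr_c_form r polydisc CARD('n) \<omega>"
    and "\<exists>T::'n current.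
           current_on polydisc (CARD('n) - 1) T \<and>
           compact (current_support polydisc (CARD('n) - 1) T) \<and>
           current_eq polydisc CARD('n) (dbar T) (current_of_form polydisc \<omega>)"
  shows "\<exists>\<eta>::'n form.
           Lr_c_form r polydisc (CARD('n) - 1) \<eta> \<and>
           current_eq polydisc CARD('n)
             (dbar (current_of_form polydisc \<eta>)) (current_of_form polydisc \<omega>)"
proof -
  note r = assms(1)
  obtain T :: "'n current" where T: "current_on polydisc (CARD('n) - 1) T"
    "compact (current_support polydisc (CARD('n) - 1) T)"
    "current_eq polydisc CARD('n) (dbar T) (current_of_form polydisc \<omega>)"
    using assms(3) by blast
  have \<omega>: "in_Lr r polydisc (\<omega> UNIV)" "compact (ess_support polydisc (\<omega> UNIV))"
    using assms(2) by (auto simp: Lr_c_form_def in_Lr_c_def)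
  obtain \<rho> where \<rho>: "0 < \<rho>" "\<rho> < 1"
    and sub: "ess_support polydisc (\<omega> UNIV) \<union> current_support polydisc (CARD('n) - 1) T \<subseteq> closed_polydisc \<rho>"
  proof (rule compact_subset_closed_polydisc)
    show "compact (ess_support polydisc (\<omega> UNIV) \<union> current_support polydisc (CARD('n) - 1) T)"
      by (intro compact_Un \<omega> T)
    show "ess_support polydisc (\<omega> UNIV) \<union> current_support polydisc (CARD('n) - 1) T \<subseteq> polydisc"
      by (auto simp: ess_support_def current_support_def distr_support_def)
  qed
  \<comment> \<open>\<open>a\<close> and \<open>b\<close> cut the interval from \<rho> to 1 into
    thirds.\<close>
  define a where "a = (2 * \<rho> + 1) / 3"
  define b where "b = (\<rho> + 2) / 3"
  have ab: "0 < a" "\<rho> < a" "a < b" "b < 1" using \<rho> by (auto simp: a_def b_def)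
  obtain f where f: "Lr_borel r f" "\<And>z. f z \<noteq> 0 \<Longrightarrow> z \<in> closed_polydisc \<rho>"
    and rep: "\<And>\<phi>. \<phi> \<in> borel_measurable borel \<Longrightarrow> distr_of_fun polydisc (\<omega> UNIV) \<phi> = (LINT z|lborel. f z * \<phi> z)"
    using in_Lr_borel_representative[OF r \<omega>(1), of \<rho>] sub by blast
  have "\<exists>g H. Lr_borel r g \<and> (\<forall>z k. g z \<noteq> 0 \<longrightarrow> cmod (z $ k) \<le> (if k \<in> (UNIV::'n set) then b else \<rho>)) \<and>
     (\<forall>j\<in>UNIV. Lr_borel r (H j) \<and> (\<forall>z k. H j z \<noteq> 0 \<longrightarrow> cmod (z $ k) \<le> b)) \<and>
     (\<forall>\<phi>\<in>test_functions polydisc. (LINT z|lborel. f z * \<phi> z) =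
        - (\<Sum>j\<in>UNIV. LINT z|lborel. H j z * dzbar j \<phi> z) + (LINT z|lborel. g z * \<phi> z)) \<and>
     (\<forall>h\<in>test_functions UNIV. (\<forall>i z. i \<notin> (UNIV::'n set) \<longrightarrow> cmod (z $ i) < a \<longrightarrow> dzbar i h z = 0) \<longrightarrow>
        (LINT z|lborel. g z * h z) = 0)"
  proof (rule cauchy_decomposition[OF ab(1,3,4) r f(1) ab(2)])
    show "cmod (z $ k) \<le> \<rho>" if "f z \<noteq> 0" for z k
      using f(2)[OF that] by (simp add: closed_polydisc_def)
    show "(LINT z|lborel. f z * h z) = 0"
      if "h \<in> test_functions UNIV" "\<And>i z. cmod (z $ i) < a \<Longrightarrow> dzbar i h z = 0" for h
      using sub by (intro form_orthogonal_to_holomorphic[OF T(1) _ T(3) ab f(2) rep that]) auto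
  qed simp
  then obtain g H where H': "\<And>j. j \<in> UNIV \<Longrightarrow> Lr_borel r (H j) \<and> (\<forall>z k. H j z \<noteq> 0 \<longrightarrow> cmod (z $ k) \<le> b)"
    and dec: "\<And>\<phi>. \<phi> \<in> test_functions polydisc \<Longrightarrow> (LINT z|lborel. f z * \<phi> z) =
        - (\<Sum>j\<in>UNIV. LINT z|lborel. H j z * dzbar j \<phi> z) + (LINT z|lborel. g z * \<phi> z)"
    and g': "\<And>h. h \<in> test_functions UNIV \<Longrightarrow> (\<forall>i z. i \<notin> (UNIV::'n set) \<longrightarrow> cmod (z $ i) < a \<longrightarrow> dzbar i h z = 0) \<longrightarrow>
        (LINT z|lborel. g z * h z) = 0"
    by blast
  have H: "Lr_borel r (H j)" "\<And>z k. H j z \<noteq> 0 \<Longrightarrow> cmod (z $ k) \<le> b" for j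
    using H'[of j] by auto
  \<comment> \<open>All coordinates are treated, so the holomorphy condition on \<open>h\<close> is
    vacuous.\<close>
  have g: "(LINT z|lborel. g z * h z) = 0" if "h \<in> test_functions UNIV" for h
    using g'[OF that] by simp
  \<comment> \<open>The sign of the term \<open>j\<close> of \<open>dbar\<close> at the full index
    set. It squares to 1, so placing it in the coefficient cancels it.\<close>
  define s :: "'n \<Rightarrow> complex" where "s j = (-1) ^ card {i. i < j}" for j
  \<comment> \<open>Index sets with \<open>CARD('n) - 1\<close> elements omit exactly one
    coordinate, which \<open>THE\<close> recovers; the values at other sets do not affect the
    form.\<close>
  define \<eta> :: "'n form" where "\<eta> I = (\<lambda>z. s (THE j. j \<notin> I) * H (THE j. j \<notin> I) z)" for I
  have \<eta>: "\<eta> (UNIV - {j}) = (\<lambda>z. s j * H j z)" for j by (simp add: \<eta>_def)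
  have s: "cmod (s j) = 1" "s j * s j = 1" for j
    by (simp_all add: s_def norm_power power_add[symmetric] mult_2[symmetric])
  have L: "Lr_borel r (\<eta> (UNIV - {j}))" for j
    unfolding \<eta> by (rule Lr_borel_bounded_mult[OF H(1) r, of _ 1]) (auto simp: s)
  have supp: "z \<in> closed_polydisc b" if "\<eta> (UNIV - {j}) z \<noteq> 0" for j z
    using that H(2)[of j z] by (auto simp: \<eta> closed_polydisc_def)
  show ?thesis
  proof (intro exI[of _ \<eta>] conjI)
    show "Lr_c_form r polydisc (CARD('n) - 1) \<eta>"
      unfolding Lr_c_form_def
    proof (intro allI impI)
      fix I :: "'n set" assume "card I = CARD('n) - 1"
      then have "card (UNIV - I) = 1"
        using zero_less_card_finite[where 'a='n] by (subst card_Diff_subset) auto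
      then obtain j where "UNIV - I = {j}" by (auto simp: card_1_singleton_iff)
      then have "I = UNIV - {j}" by auto
      then show "in_Lr_c r polydisc (\<eta> I)"
        using Lr_borel_imp_in_Lr_c(1)[OF r L supp ab(4)] by simp
    qed
    show "current_eq polydisc CARD('n) (dbar (current_of_form polydisc \<eta>)) (current_of_form polydisc \<omega>)"
      unfolding current_eq_def
    proof (intro allI impI ballI)
      fix I :: "'n set" and \<phi> :: "(complex, 'n) vec \<Rightarrow> complex"
      assume "card I = CARD('n)" and \<phi>: "\<phi> \<in> test_functions polydisc"
      then have I: "I = UNIV" by (simp add: card_eq_UNIV_imp_eq_UNIV)
      have "s j * distr_dzbar j (current_of_form polydisc \<eta> (UNIV - {j})) \<phi> = - (LINT z|lborel. H j z * dzbar j \<phi> z)" for j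
      proof -
        have "distr_of_fun polydisc (\<eta> (UNIV - {j})) (dzbar j \<phi>) = (LINT z|lborel. \<eta> (UNIV - {j}) z * dzbar j \<phi> z)"
          by (intro Lr_borel_imp_in_Lr_c(2)[OF r L supp ab(4)] smooth_fun_borel_measurable
               smooth_fun_dzbar test_functions_smooth[OF \<phi>])
        also have "\<dots> = s j * (LINT z|lborel. H j z * dzbar j \<phi> z)"
          by (simp add: \<eta> mult.assoc)
        finally have "s j * distr_of_fun polydisc (\<eta> (UNIV - {j})) (dzbar j \<phi>) = (LINT z|lborel. H j z * dzbar j \<phi> z)"
          by (simp add: mult.assoc[symmetric] s)
        then show ?thesis by (simp add: distr_dzbar_def current_of_form_def)
      qed
      then have "dbar (current_of_form polydisc \<eta>) I \<phi> = - (\<Sum>j\<in>UNIV. LINT z|lborel. H j z * dzbar j \<phi> z)"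
        by (simp add: dbar_def I s_def[symmetric] sum_negf)
      also have "\<dots> = (LINT z|lborel. f z * \<phi> z)"
        using dec[OF \<phi>] g[OF test_functions_mono[OF \<phi>]] by simp
      also have "\<dots> = current_of_form polydisc \<omega> I \<phi>"
        by (simp add: current_of_form_def I rep smooth_fun_borel_measurable test_functions_smooth[OF \<phi>])
      finally show "dbar (current_of_form polydisc \<eta>) I \<phi> = current_of_form polydisc \<omega> I \<phi>" .
    qed
  qed
qed

end
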